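(* Let $n\in\mathbb{N}$, let $B_n^+$ be the braid monoid on $n$ strands with set of atoms $\mathcal{A}=\{\sigma_1,\ldots,\sigma_{n-1}\}$, and let $T$ be the transition matrix of the automaton $\mathfrak{T}$ described in the context; that is, for $X,Z\subseteq\mathcal{A}$, $T_{Z,X}$ is the number of transitions from the state $X$ of $\mathfrak{T}$ to the state $Z$ of $\mathfrak{T}$. If $X_1,X_2\subseteq\mathcal{A}$ are such that the partitions of $n$ given by $\deg(\mathcal{A}\setminus X_1)$ and $\deg(\mathcal{A}\setminus X_2)$ are equal, then $T_{Z,X_1}=T_{Z,X_2}$ for all $Z\subseteq\mathcal{A}$; that is, the columns $X_1$ and $X_2$ of the transition matrix of $\mathfrak{T}$ are identical.
   Context: $B_n^+$ is the monoid with generators $\sigma_1,\ldots,\sigma_{n-1}$ and relations $\sigma_i\sigma_{i+1}\sigma_i=\sigma_{i+1}\sigma_i\sigma_{i+1}$ for $1\le i\le n-2$ and $\sigma_i\sigma_j=\sigma_j\sigma_i$ for $|i-j|\ge2$. For $x,y\in B_n^+$ write $x\preccurlyeq y$ if $xc=y$ for some $c\in B_n^+$, and $x\succcurlyeq y$ if $x=cy$ for some $c\in B_n^+$. The Garside element $\Delta$ is the $\preccurlyeq$-least common multiple of the atoms (equal to the $\succcurlyeq$-least common multiple of the atoms), and $D=\{s\mid s\preccurlyeq\Delta\}=\{s\mid\Delta\succcurlyeq s\}$ is the finite set of simple elements. The starting set and finishing set of $x$ are $S(x)=\{a\in\mathcal{A}\mid a\preccurlyeq x\}$ and $F(x)=\{a\in\mathcal{A}\mid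 x\succcurlyeq a\}$. The canonical map $\pi:D\to\mathfrak{S}_n$ (sending a simple element to the permutation $\pi_s$ it induces on the $n$ strands, with $\pi(\sigma_i)$ the transposition $(i\ \ i+1)$) is a bijection; for $s\in D$ one has $\sigma_i\preccurlyeq s$ iff $\pi_s(i)>\pi_s(i+1)$, and $s\succcurlyeq\sigma_i$ iff $\pi_s^{-1}(i)>\pi_s^{-1}(i+1)$. The automaton $\mathfrak{T}$ has state set $\mathcal{P}(\mathcal{A})$ (the power set), alphabet $D$, initial state $\mathcal{A}$, accept states $\mathcal{P}(\mathcal{A})\setminus\{\emptyset\}$, and transition function $(X,s)\mapsto F(s)$ if $S(s)\subseteq X$ and $(X,s)\mapsto\emptyset$ otherwise. Each letter $s\in D$ gives one transition from each state. For $Z\subseteq\mathcal{A}$, the orbits on $\{1,\ldots,n\}$ of the subgroup $\langle\pi(Z)\rangle\le\mathfrak{S}_n$ generated by $\{\pi(a)\mid a\in Z\}$ are sets of consecutive integers; if $O_1,\ldots,O_r$ are these orbits in their natural order, then $\deg(Z)=[|O_1|,\ldots,|O_r|]$. The partition of $n$ given by $\deg(Z)$ is obtained by forgetting the order of the entries. *)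

theory Defs
  imports
    "HOL-Algebra.Divisibility"
    "HOL-Algebra.Group_Action"
    "HOL-Algebra.Sym_Groups"
    "HOL-Combinatorics.Transposition"
    "HOL-Library.Multiset"
begin

section \<open>Presented monoids\<close>

text \<open>The congruence on the words over \<open>A\<close> generated by a set \<open>R\<close> of relations.\<close>

inductive_set monoid_cong :: "'a set \<Rightarrow> ('a list \<times> 'a list) set \<Rightarrow> ('a list \<times> 'a list) set"
  for A :: "'a set" and R :: "('a list \<times> 'a list) set" where
  refl: "w \<in> lists A \<Longrightarrow> (w, w) \<in> monoid_cong A R"
| rel: "(u, v) \<in> R \<Longrightarrow> u \<in> lists A \<Longrightarrow> v \<in> lists A \<Longrightarrow> x \<in> lists A \<Longrightarrow> y \<in> lists A
    \<Longrightarrow> (x @ u @ y, x @ v @ y) \<in> monoid_cong A R"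
| sym: "(u, v) \<in> monoid_cong A R \<Longrightarrow> (v, u) \<in> monoid_cong A R"
| trans: "(u, v) \<in> monoid_cong A R \<Longrightarrow> (v, w) \<in> monoid_cong A R \<Longrightarrow> (u, w) \<in> monoid_cong A R"

definition presented_monoid :: "'a set \<Rightarrow> ('a list \<times> 'a list) set \<Rightarrow> 'a list set monoid" where
  "presented_monoid A R =
    \<lparr> carrier = lists A // monoid_cong A R,
      mult = (\<lambda>x y. \<Union>u\<in>x. \<Union>v\<in>y. monoid_cong A R `` {u @ v}),
      one = monoid_cong A R `` {[]} \<rparr>"


section \<open>The braid monoid\<close>

text \<open>The letter \<open>i\<close> stands for the generator \<open>\<sigma>\<^sub>i\<close>.\<close>

definition braid_relations :: "nat \<Rightarrow> (nat list \<times> nat list) set" where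
  "braid_relations n =
    {([i, i + 1, i], [i + 1, i, i + 1]) | i. 1 \<le> i \<and> i + 2 \<le> n} \<union>
    {([i, j], [j, i]) | i j. i \<in> {1..<n} \<and> j \<in> {1..<n} \<and> \<bar>int i - int j\<bar> \<ge> 2}"

definition braid_monoid :: "nat \<Rightarrow> nat list set monoid" where
  "braid_monoid n = presented_monoid {1..<n} (braid_relations n)"

definition sigma :: "nat \<Rightarrow> nat \<Rightarrow> nat list set" where
  "sigma n i = monoid_cong {1..<n} (braid_relations n) `` {[i]}"

definition atoms :: "nat \<Rightarrow> nat list set set" where
  "atoms n = sigma n ` {1..<n}"

text \<open>The relation \<open>x \<preceq> y\<close> (\<open>x\<close> is a prefix of \<open>y\<close>) is the relation
  \<^const>\<open>factor\<close> of \<^theory>\<open>HOL-Algebra.Divisibility\<close>, which in a non-commutative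
  monoid is left divisibility. The following is \<open>x \<succeq> y\<close> (\<open>y\<close> is a suffix of \<open>x\<close>).\<close>

definition has_suffix :: "('a, 'b) monoid_scheme \<Rightarrow> 'a \<Rightarrow> 'a \<Rightarrow> bool" where
  "has_suffix G x y \<longleftrightarrow> (\<exists>c\<in>carrier G. x = c \<otimes>\<^bsub>G\<^esub> y)"

definition is_prefix_lcm :: "('a, 'b) monoid_scheme \<Rightarrow> 'a set \<Rightarrow> 'a \<Rightarrow> bool" where
  "is_prefix_lcm G M m \<longleftrightarrow> m \<in> carrier G \<and> (\<forall>a\<in>M. a divides\<^bsub>G\<^esub> m) \<and>
     (\<forall>y\<in>carrier G. (\<forall>a\<in>M. a divides\<^bsub>G\<^esub> y) \<longrightarrow> m divides\<^bsub>G\<^esub> y)"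

definition garside :: "nat \<Rightarrow> nat list set" where
  "garside n = (THE d. is_prefix_lcm (braid_monoid n) (atoms n) d)"

definition simple_elements :: "nat \<Rightarrow> nat list set set" where
  "simple_elements n = {s \<in> carrier (braid_monoid n). s divides\<^bsub>braid_monoid n\<^esub> garside n}"

definition starting_set :: "nat \<Rightarrow> nat list set \<Rightarrow> nat list set set" where
  "starting_set n x = {a \<in> atoms n. a divides\<^bsub>braid_monoid n\<^esub> x}"

definition finishing_set :: "nat \<Rightarrow> nat list set \<Rightarrow> nat list set set" where
  "finishing_set n x = {a \<in> atoms n. has_suffix (braid_monoid n) x a}"


section \<open>The automaton and its transition matrix\<close>

record ('q, 'l) automaton =
  states :: "'q set"
  alphabet :: "'l set"
  initial :: 'q
  accepting :: "'q set"
  transition :: "'q \<Rightarrow> 'l \<Rightarrow> 'q"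

text \<open>The entry in row \<open>q'\<close> and column \<open>q\<close> is the number of transitions from \<open>q\<close> to \<open>q'\<close>;
  each letter gives one transition out of every state.\<close>

definition transition_matrix :: "('q, 'l) automaton \<Rightarrow> 'q \<Rightarrow> 'q \<Rightarrow> nat" where
  "transition_matrix M q' q = card {l \<in> alphabet M. transition M q l = q'}"

definition braid_automaton :: "nat \<Rightarrow> (nat list set set, nat list set) automaton" where
  "braid_automaton n =
    \<lparr> states = Pow (atoms n),
      alphabet = simple_elements n,
      initial = atoms n,
      accepting = Pow (atoms n) - {{}},
      transition = (\<lambda>X s. if starting_set n s \<subseteq> X then finishing_set n s else {}) \<rparr>"


section \<open>Degrees of sets of atoms\<close>

text \<open>Permutations act so that \<open>\<pi>\<close> of a product \<open>x y\<close> is \<open>\<pi> y \<circ> \<pi> x\<close>. This is the convention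
  under which, for a simple element \<open>s\<close>, the generator \<open>\<sigma>\<^sub>i\<close> is a prefix of \<open>s\<close> iff
  \<open>\<pi> s i > \<pi> s (i + 1)\<close>.\<close>

primrec word_perm :: "nat list \<Rightarrow> nat \<Rightarrow> nat" where
  "word_perm [] = id"
| "word_perm (i # w) = word_perm w \<circ> transpose i (i + 1)"

text \<open>\<^const>\<open>word_perm\<close> respects the braid relations, so its image of a congruence class is a
  singleton.\<close>

definition strand_perm :: "nat list set \<Rightarrow> nat \<Rightarrow> nat" where
  "strand_perm x = the_elem (word_perm ` x)"

definition perm_subgroup :: "nat \<Rightarrow> nat list set set \<Rightarrow> (nat \<Rightarrow> nat) monoid" where
  "perm_subgroup n Z = (sym_group n)\<lparr>carrier := generate (sym_group n) (strand_perm ` Z)\<rparr>"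

text \<open>The orbits are listed in the order of their least elements, which for sets of consecutive
  integers is their natural order.\<close>

definition deg :: "nat \<Rightarrow> nat list set set \<Rightarrow> nat list" where
  "deg n Z = map (\<lambda>m. card (orbit (perm_subgroup n Z) (\<lambda>p. p) m))
     (sorted_list_of_set (Min ` orbits (perm_subgroup n Z) {1..n} (\<lambda>p. p)))"

text \<open>A partition of \<open>n\<close> is represented as the multiset of its parts.\<close>

definition deg_partition :: "nat \<Rightarrow> nat list set set \<Rightarrow> nat multiset" where
  "deg_partition n Z = mset (deg n Z)"

end

theory Submission
  imports Defs
begin

text \<open>A simple element corresponds to the permutation it induces, and its starting and finishing
  sets to the descents of the permutation and of its inverse. This rests on Matsumoto's theorem and on
  Garside's theorem that the monoid is cancellative and that \<open>\<sigma>\<^sub>i\<close> and \<open>\<sigma>\<^sub>j\<close> have the expected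
  least common multiple, from which the least common multiple of all atoms is found to be the
  positive lift of the longest permutation.

  By inclusion-exclusion it then suffices to count, for all \<open>K\<close>, the permutations \<open>p\<close> with
  descents in \<open>X\<close> whose inverses have descents in \<open>K\<close>. Each double coset of the two Young subgroups
  given by \<open>X\<close> and \<open>K\<close> contains exactly one of them, and a double coset is determined by
  the table which counts, for every pair of a block of \<open>X\<close> and a block of \<open>K\<close>, the points of the first
  that \<open>p\<close> maps to the second. Permuting blocks of \<open>X\<close> permutes the rows of the tables, so the number
  of tables only depends on the multiset of block sizes of \<open>X\<close>, which is the partition of \<open>n\<close>
  given by the degree of the complement of \<open>X\<close>.\<close>

section \<open>Inversions of permutations\<close>

text \<open>The automaton compares the starting set of a letter with X by inclusion, and this makes
  the count tractable: containment of descents singles out the shortest elements of double cosets,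
  whereas an exactly prescribed descent set has no such description. So only the condition on the
  inverse, an equality, is passed through inclusion-exclusion. On the monoid side the obstacle is
  that the Garside element is given by a definite description: a least common multiple of all atoms
  has to be shown to exist, while the relations only speak of two generators at a time. Word length,
  which the relations preserve, carries the argument: it orders the induction behind the pairwise
  least common multiples, bounds the maximal choices made later, and gives uniqueness, as elements
  dividing each other have equal length. In the counting, blocks are recorded by a function that
  names them, and order arguments stand in for cosets.\<close>

definition inversions :: "nat \<Rightarrow> (nat \<Rightarrow> nat) \<Rightarrow> (nat \<times> nat) set" where
  "inversions n p = {(a, b). a \<in> {1..n} \<and> b \<in> {1..n} \<and> a < b \<and> p b < p a}"

definition inv_count :: "nat \<Rightarrow> (nat \<Rightarrow> nat) \<Rightarrow> nat" where
  "inv_count n p = card (inversions n p)"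

lemma finite_inversions [simp]: "finite (inversions n p)"
  by (rule finite_subset[of _ "{1..n} \<times> {1..n}"]) (auto simp: inversions_def)

lemma inv_count_id [simp]: "inv_count n id = 0"
proof -
  have "inversions n id = {}" by (auto simp: inversions_def)
  then show ?thesis by (simp add: inv_count_def)
qed

lemma adjacent_transpose_permutes:
  "i \<in> {1..<n} \<Longrightarrow> transpose i (Suc i) permutes {1..n}"
  by (rule permutes_swap_id) auto

lemma adjacent_transpose_less:
  fixes a b i :: nat
  assumes "a < b" "(a, b) \<noteq> (i, Suc i)"
  shows "transpose i (Suc i) a < transpose i (Suc i) b"
  using assms by (auto simp: transpose_def)

text \<open>The transposition is increasing on every pair of positions other than
  \<open>(i, Suc i)\<close>, so it carries inversions to inversions, and the exchanged pair is the
  only new one.\<close>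

lemma inversions_comp_transpose:
  assumes "i \<in> {1..<n}" "p i < p (Suc i)"
  shows "inversions n (p \<circ> transpose i (Suc i)) =
    insert (i, Suc i) (map_prod (transpose i (Suc i)) (transpose i (Suc i)) ` inversions n p)"
    (is "?L = insert _ (map_prod ?t ?t ` ?R)")
proof (intro subset_antisym subsetI)
  have t: "?t x \<in> {1..n} \<longleftrightarrow> x \<in> {1..n}" for x
    using permutes_in_image[OF adjacent_transpose_permutes[OF assms(1)]] .
  fix z assume "z \<in> ?L"
  then obtain a b where z: "z = (a, b)" "a \<in> {1..n}" "b \<in> {1..n}" "a < b" "p (?t b) < p (?t a)"
    by (auto simp: inversions_def)
  show "z \<in> insert (i, Suc i) (map_prod ?t ?t ` ?R)"
  proof (cases "(a, b) = (i, Suc i)")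
    case False
    then have "(?t a, ?t b) \<in> ?R"
      using z t adjacent_transpose_less[OF z(4) False] unfolding inversions_def by blast
    moreover have "(a, b) = map_prod ?t ?t (?t a, ?t b)" by simp
    ultimately show ?thesis using z(1) by blast
  qed (simp add: z)
next
  have t: "?t x \<in> {1..n} \<longleftrightarrow> x \<in> {1..n}" for x
    using permutes_in_image[OF adjacent_transpose_permutes[OF assms(1)]] .
  fix z assume "z \<in> insert (i, Suc i) (map_prod ?t ?t ` ?R)"
  then consider "z = (i, Suc i)" | a b where "z = (?t a, ?t b)" "(a, b) \<in> ?R" by auto
  then show "z \<in> ?L"
  proof cases
    case 1 then show ?thesis using assms by (auto simp: inversions_def)
  next
    case 2
    then have "(a, b) \<noteq> (i, Suc i)" using assms(2) by (auto simp: inversions_def)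
    then show ?thesis using 2 t adjacent_transpose_less[of a b i] unfolding inversions_def by auto
  qed
qed

lemma inv_count_comp_transpose_ascent:
  assumes "i \<in> {1..<n}" "p i < p (Suc i)"
  shows "inv_count n (p \<circ> transpose i (Suc i)) = Suc (inv_count n p)"
proof -
  let ?t = "transpose i (Suc i)"
  have "(i, Suc i) \<notin> map_prod ?t ?t ` inversions n p"
  proof
    assume "(i, Suc i) \<in> map_prod ?t ?t ` inversions n p"
    then obtain a b where "(a, b) \<in> inversions n p" "?t a = i" "?t b = Suc i" by auto
    then have "a = Suc i" "b = i" by (auto simp: transpose_def split: if_splits)
    then show False using \<open>(a, b) \<in> _\<close> by (auto simp: inversions_def)
  qed
  moreover have "inj_on (map_prod ?t ?t) (inversions n p)"
    by (rule inj_on_subset[OF prod.inj_map]) (auto simp: inj_swap)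
  ultimately show ?thesis
    unfolding inv_count_def inversions_comp_transpose[of i n p, OF assms] by (simp add: card_image)
qed

lemma comp_transpose_transpose [simp]: "p \<circ> transpose a b \<circ> transpose a b = p"
  by (simp add: comp_assoc)

lemma inv_count_comp_transpose_descent:
  assumes "i \<in> {1..<n}" "p (Suc i) < p i"
  shows "inv_count n p = Suc (inv_count n (p \<circ> transpose i (Suc i)))"
  using inv_count_comp_transpose_ascent[of i n "p \<circ> transpose i (Suc i)"] assms by simp

lemma permutes_adjacent_cases:
  fixes p :: "nat \<Rightarrow> nat"
  assumes "p permutes S"
  obtains "p i < p (Suc i)" | "p (Suc i) < p i"
proof -
  have "p i \<noteq> p (Suc i)" using permutes_inj[OF assms] by (simp add: inj_eq)
  then show ?thesis using that by linarith
qed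

lemma inv_count_inv:
  assumes "p permutes {1..n}"
  shows "inv_count n (inv' p) = inv_count n p"
proof -
  have inj: "inj (\<lambda>(a, b). (p b, p a))"
    using permutes_inj[OF assms] by (auto simp: inj_on_def)
  have pin: "p x \<in> {1..n} \<longleftrightarrow> x \<in> {1..n}" for x using permutes_in_image[OF assms] .
  have "inversions n (inv' p) = (\<lambda>(a, b). (p b, p a)) ` inversions n p"
  proof (intro subset_antisym subsetI)
    fix z assume "z \<in> inversions n (inv' p)"
    then obtain c d where z: "z = (c, d)" "c \<in> {1..n}" "d \<in> {1..n}" "c < d" "inv' p d < inv' p c"
      by (auto simp: inversions_def)
    have "(inv' p d, inv' p c) \<in> inversions n p"
      using z pin[of "inv' p c"] pin[of "inv' p d"] permutes_inverses[OF assms]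
      by (auto simp: inversions_def)
    moreover have "z = (\<lambda>(a, b). (p b, p a)) (inv' p d, inv' p c)"
      using z permutes_inverses[OF assms] by simp
    ultimately show "z \<in> (\<lambda>(a, b). (p b, p a)) ` inversions n p" by blast
  next
    fix z assume "z \<in> (\<lambda>(a, b). (p b, p a)) ` inversions n p"
    then show "z \<in> inversions n (inv' p)"
      using pin permutes_inverses[OF assms] by (auto simp: inversions_def)
  qed
  then show ?thesis
    unfolding inv_count_def using inj by (simp add: card_image inj_on_subset)
qed

section \<open>Permutations determined by the order they induce\<close>

lemma permutes_rank:
  fixes p :: "nat \<Rightarrow> nat"
  assumes "p permutes {1..n}" "v \<in> {1..n}"
  shows "p v = card {u \<in> {1..n}. p u \<le> p v}"
proof -
  have "p ` {u \<in> {1..n}. p u \<le> p v} = {1..p v}"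
  proof (intro subset_antisym subsetI)
    fix x assume x: "x \<in> {1..p v}"
    moreover have "p v \<in> {1..n}" using permutes_in_image[OF assms(1)] assms(2) by blast
    ultimately have "x \<in> p ` {1..n}" using permutes_image[OF assms(1)] by auto
    then show "x \<in> p ` {u \<in> {1..n}. p u \<le> p v}" using x by auto
  next
    fix x assume "x \<in> p ` {u \<in> {1..n}. p u \<le> p v}"
    then show "x \<in> {1..p v}" using permutes_in_image[OF assms(1)] by auto
  qed
  then have "card (p ` {u \<in> {1..n}. p u \<le> p v}) = p v" by simp
  then show ?thesis
    using card_image[OF inj_on_subset[OF permutes_inj[OF assms(1)] subset_UNIV]] by simp
qed

text \<open>Each value is recovered as its rank, so only the comparisons matter. This gives
  uniqueness of the permutation with no descents and of the one with all descents, and later the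
  reconstruction from a table.\<close>

lemma permutes_eqI:
  fixes p q :: "nat \<Rightarrow> nat"
  assumes "p permutes {1..n}" "q permutes {1..n}"
    and "\<And>u v. u \<in> {1..n} \<Longrightarrow> v \<in> {1..n} \<Longrightarrow> p u \<le> p v \<longleftrightarrow> q u \<le> q v"
  shows "p = q"
proof
  fix v show "p v = q v"
  proof (cases "v \<in> {1..n}")
    case True
    then have "{u \<in> {1..n}. p u \<le> p v} = {u \<in> {1..n}. q u \<le> q v}" using assms(3) by blast
    then show ?thesis using permutes_rank[OF assms(1) True] permutes_rank[OF assms(2) True] by simp
  next
    case False then show ?thesis using assms by (simp add: permutes_not_in)
  qed
qed

text \<open>Stated for an arbitrary transitive relation because it is applied to \<open><\<close>,
  \<open>>\<close> and \<open>\<le>\<close>.\<close>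

lemma chain_interval:
  fixes R :: "'a \<Rightarrow> 'a \<Rightarrow> bool" and f :: "nat \<Rightarrow> 'a"
  assumes "transp R" "u < v" "\<And>i. u \<le> i \<Longrightarrow> i < v \<Longrightarrow> R (f i) (f (Suc i))"
  shows "R (f u) (f v)"
  using assms(2,3)
proof (induction v)
  case (Suc v)
  show ?case
  proof (cases "u = v")
    case False
    then have "R (f u) (f v)" using Suc by simp
    then show ?thesis using Suc.prems assms(1) by (meson Suc_leI lessI less_Suc_eq_le transpD)
  qed (use Suc in simp)
qed simp

lemma permutes_eq_id_if_no_descents:
  fixes p q :: "nat \<Rightarrow> nat"
  assumes "p permutes {1..n}" "\<And>i. i \<in> {1..<n} \<Longrightarrow> p i < p (Suc i)"
  shows "p = id"
proof (rule permutes_eqI[OF assms(1) permutes_id])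
  have less: "p u < p v" if "u < v" "u \<in> {1..n}" "v \<in> {1..n}" for u v
    using chain_interval[of "(<)" u v p] assms(2) that by simp
  show "p u \<le> p v \<longleftrightarrow> id u \<le> id v" if "u \<in> {1..n}" "v \<in> {1..n}" for u v
    using less[of u v] less[of v u] that by (cases u v rule: linorder_cases) auto
qed

lemma permutes_eq_if_all_descents:
  fixes p q :: "nat \<Rightarrow> nat"
  assumes "p permutes {1..n}" "\<And>i. i \<in> {1..<n} \<Longrightarrow> p (Suc i) < p i"
    and "q permutes {1..n}" "\<And>i. i \<in> {1..<n} \<Longrightarrow> q (Suc i) < q i"
  shows "p = q"
proof (rule permutes_eqI[OF assms(1,3)])
  have less: "r v < r u" if "u < v" "u \<in> {1..n}" "v \<in> {1..n}"
    and "\<And>i. i \<in> {1..<n} \<Longrightarrow> r (Suc i) < r i" for u v and r :: "nat \<Rightarrow> nat"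
    using chain_interval[of "(>)" u v r] that by (simp add: transp_def)
  show "p u \<le> p v \<longleftrightarrow> q u \<le> q v" if "u \<in> {1..n}" "v \<in> {1..n}" for u v
    using less[of u v p] less[of v u p] less[of u v q] less[of v u q] that assms(2,4)
    by (cases u v rule: linorder_cases) auto
qed

definition descents :: "nat \<Rightarrow> (nat \<Rightarrow> nat) \<Rightarrow> nat set" where
  "descents n p = {i \<in> {1..<n}. p (Suc i) < p i}"

section \<open>Words in the braid monoid\<close>

lemma monoid_cong_lists:
  assumes "(u, v) \<in> monoid_cong A R"
  shows "u \<in> lists A" "v \<in> lists A"
  using assms by (induction rule: monoid_cong.induct) auto

lemma monoid_cong_append_left:
  assumes "(u, v) \<in> monoid_cong A R" "x \<in> lists A"
  shows "(x @ u, x @ v) \<in> monoid_cong A R"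
  using assms
proof (induction rule: monoid_cong.induct)
  case (rel u v y z)
  then show ?case using monoid_cong.rel[of u v R A "x @ y" z] by simp
next
  case (refl w)
  then show ?case by (intro monoid_cong.refl) auto
qed (auto intro: monoid_cong.intros)

lemma monoid_cong_append_right:
  assumes "(u, v) \<in> monoid_cong A R" "x \<in> lists A"
  shows "(u @ x, v @ x) \<in> monoid_cong A R"
  using assms
proof (induction rule: monoid_cong.induct)
  case (rel u v y z)
  then show ?case using monoid_cong.rel[of u v R A y "z @ x"] by simp
next
  case (refl w)
  then show ?case by (intro monoid_cong.refl) auto
qed (auto intro: monoid_cong.intros)

lemma monoid_cong_append:
  assumes "(u, v) \<in> monoid_cong A R" "(u', v') \<in> monoid_cong A R"
  shows "(u @ u', v @ v') \<in> monoid_cong A R"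
  using monoid_cong_append_left[OF assms(2) monoid_cong_lists(1)[OF assms(1)]]
    monoid_cong_append_right[OF assms(1) monoid_cong_lists(2)[OF assms(2)]]
  by (rule monoid_cong.trans)

abbreviation braid_eq :: "nat \<Rightarrow> nat list \<Rightarrow> nat list \<Rightarrow> bool" where
  "braid_eq n u v \<equiv> (u, v) \<in> monoid_cong {1..<n} (braid_relations n)"

definition braid :: "nat \<Rightarrow> nat list \<Rightarrow> nat list set" where
  "braid n w = monoid_cong {1..<n} (braid_relations n) `` {w}"

lemma braid_relations_cases [consumes 1, case_names near far]:
  assumes "(u, v) \<in> braid_relations n"
  obtains i where "1 \<le> i" "Suc (Suc i) \<le> n" "u = [i, Suc i, i]" "v = [Suc i, i, Suc i]"
  | i j where "i \<in> {1..<n}" "j \<in> {1..<n}" "\<bar>int i - int j\<bar> \<ge> 2" "u = [i, j]" "v = [j, i]"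
  using assms unfolding braid_relations_def by auto

lemma braid_eq_iff:
  assumes "u \<in> lists {1..<n}"
  shows "braid n u = braid n v \<longleftrightarrow> braid_eq n u v"
proof
  assume "braid n u = braid n v"
  then have "u \<in> braid n v" using monoid_cong.refl[OF assms] by (auto simp: braid_def)
  then show "braid_eq n u v" by (auto simp: braid_def intro: monoid_cong.sym)
next
  assume "braid_eq n u v"
  then show "braid n u = braid n v"
    by (auto simp: braid_def intro: monoid_cong.trans monoid_cong.sym)
qed

text \<open>The congruence relates only words over the alphabet. Other words thus have the empty
  class, and equations between classes can be stated for all words.\<close>

lemma braid_notin_lists: "w \<notin> lists {1..<n} \<Longrightarrow> braid n w = {}"
  by (auto simp: braid_def dest: monoid_cong_lists(1))

declare word_perm.simps(2) [simp del]

lemma word_perm_Cons [simp]: "word_perm (i # w) = word_perm w \<circ> transpose i (Suc i)"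
  by (simp add: word_perm.simps(2))

text \<open>In the following inductions the goals are eta-expanded equations between functions, in which
  \<open>comp_apply\<close> would unfold the compositions.\<close>

lemma word_perm_append: "word_perm (u @ v) = word_perm v \<circ> word_perm u"
  by (induction u) (simp_all add: comp_assoc del: comp_apply id_apply)

text \<open>Both kinds of relation are homogeneous and hold for transpositions. Invariance of length
  supplies the measure for the inductions and maximality arguments on words.\<close>

lemma braid_eq_invariant:
  assumes "braid_eq n u v"
  shows "length u = length v" "word_perm u = word_perm v"
proof -
  have "length u = length v \<and> word_perm u = word_perm v"
    using assms
  proof (induction rule: monoid_cong.induct)
    case (rel u v x y)
    have "length u = length v \<and> word_perm u = word_perm v"
      using rel(1) by (auto simp: braid_relations_def fun_eq_iff transpose_def)
    then show ?case by (simp add: word_perm_append)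
  qed auto
  then show "length u = length v" "word_perm u = word_perm v" by auto
qed

section \<open>Garside's cancellation theorem\<close>

definition adjacent :: "nat \<Rightarrow> nat \<Rightarrow> bool" where
  "adjacent i j \<longleftrightarrow> j = Suc i \<or> i = Suc j"

lemma adjacent_commute: "adjacent i j \<longleftrightarrow> adjacent j i"
  by (auto simp: adjacent_def)

text \<open>The braid \<open>\<sigma>\<^sub>i\<close> times the braid of \<open>complement i j\<close> is the least common multiple of
  \<open>\<sigma>\<^sub>i\<close> and \<open>\<sigma>\<^sub>j\<close>.\<close>

definition complement :: "nat \<Rightarrow> nat \<Rightarrow> nat list" where
  "complement i j = (if i = j then [] else if adjacent i j then [j, i] else [j])"

text \<open>Since \<open>lmul n i\<close> distributes over unions, the braid relations hold for it on all sets.\<close>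

definition lmul :: "nat \<Rightarrow> nat \<Rightarrow> nat list set \<Rightarrow> nat list set" where
  "lmul n i x = (\<Union>w\<in>x. braid n (i # w))"

lemma braid_Cons: "braid n (i # w) = lmul n i (braid n w)"
proof (cases "i # w \<in> lists {1..<n}")
  case True
  have "braid n (i # v) = braid n (i # w)" if "braid_eq n w v" for v
    using braid_eq_iff[OF True, of "i # v"] monoid_cong_append_left[OF that, of "[i]"] True by simp
  moreover have "w \<in> braid n w" using True by (auto simp: braid_def intro: monoid_cong.refl)
  moreover have "v \<in> braid n w \<longleftrightarrow> braid_eq n w v" for v by (simp add: braid_def)
  ultimately show ?thesis unfolding lmul_def by blast
next
  case False
  have "braid n (i # v) = {}" if "v \<in> braid n w" for v
  proof (rule braid_notin_lists)
    have "braid_eq n w v" using that by (simp add: braid_def)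
    then show "i # v \<notin> lists {1..<n}" using False monoid_cong_lists(1)[of w v] by auto
  qed
  then show ?thesis using braid_notin_lists[OF False] by (simp add: lmul_def)
qed

lemma lmul_lmul: "lmul n i (lmul n j x) = (\<Union>w\<in>x. braid n (i # j # w))"
proof -
  have "lmul n i (lmul n j x) = (\<Union>w\<in>x. lmul n i (braid n (j # w)))"
    unfolding lmul_def by (rule UN_UN_flatten)
  then show ?thesis by (simp only: braid_Cons)
qed

lemma lmul_commute:
  assumes "i \<in> {1..<n}" "j \<in> {1..<n}" "i \<noteq> j" "\<not> adjacent i j"
  shows "lmul n i (lmul n j x) = lmul n j (lmul n i x)"
proof -
  have rel: "([i, j], [j, i]) \<in> braid_relations n"
    using assms by (auto simp: braid_relations_def adjacent_def)
  have "braid n (i # j # w) = braid n (j # i # w)" for w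
  proof (cases "w \<in> lists {1..<n}")
    case True
    then show ?thesis using braid_eq_iff[of "i # j # w" n] assms
        monoid_cong.rel[OF rel, of "{1..<n}" "[]" w] by simp
  qed (simp add: braid_notin_lists)
  then show ?thesis by (simp add: lmul_lmul)
qed

lemma lmul_braid:
  assumes "i \<in> {1..<n}" "j \<in> {1..<n}" "adjacent i j"
  shows "lmul n i (lmul n j (lmul n i x)) = lmul n j (lmul n i (lmul n j x))"
proof -
  have *: "lmul n i (lmul n (Suc i) (lmul n i x)) = lmul n (Suc i) (lmul n i (lmul n (Suc i) x))"
    if i: "i \<in> {1..<n}" "Suc i \<in> {1..<n}" for i
  proof -
    have rel: "([i, Suc i, i], [Suc i, i, Suc i]) \<in> braid_relations n"
      using i by (auto simp: braid_relations_def)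
    have "braid n (i # Suc i # i # w) = braid n (Suc i # i # Suc i # w)" for w
    proof (cases "w \<in> lists {1..<n}")
      case True
      then show ?thesis using braid_eq_iff[of "i # Suc i # i # w" n] i
          monoid_cong.rel[OF rel, of "{1..<n}" "[]" w] by simp
    qed (simp add: braid_notin_lists)
    moreover have "lmul n k (\<Union>w\<in>x. braid n (f w)) = (\<Union>w\<in>x. braid n (k # f w))" for k f
    proof -
      have "lmul n k (\<Union>w\<in>x. braid n (f w)) = (\<Union>w\<in>x. lmul n k (braid n (f w)))"
        unfolding lmul_def by (rule UN_UN_flatten)
      then show ?thesis by (simp only: braid_Cons)
    qed
    ultimately show ?thesis by (simp add: lmul_lmul)
  qed
  show ?thesis using assms *[of i] *[of j] by (auto simp: adjacent_def)
qed

text \<open>A property of two whole words, with the first letters quantified inside, so that rule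
  induction on the congruence applies. For congruent words it says that both factor, with a common
  remainder \<open>Z\<close>, through the least common multiple of their first letters; on empty
  words it holds vacuously.\<close>

definition lcm_property :: "nat \<Rightarrow> nat list \<Rightarrow> nat list \<Rightarrow> bool" where
  "lcm_property n u v \<longleftrightarrow> (\<forall>i X j Y. u = i # X \<longrightarrow> v = j # Y \<longrightarrow>
     (\<exists>Z. braid_eq n X (complement i j @ Z) \<and> braid_eq n Y (complement j i @ Z)))"

text \<open>The cube condition for three generators, by which common multiples can be computed along a
  chain of elementary moves.\<close>

lemma complement_cube:
  assumes lcm: "\<And>u v. length u \<le> r \<Longrightarrow> braid_eq n u v \<Longrightarrow> lcm_property n u v"
    and in_range: "i \<in> {1..<n}" "m \<in> {1..<n}" "k \<in> {1..<n}"
    and eq: "braid_eq n (complement m i @ Z1) (complement m k @ Z2)"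
    and len: "length (complement m i @ Z1) \<le> r"
  shows "\<exists>Z. braid_eq n (complement i m @ Z1) (complement i k @ Z) \<and>
    braid_eq n (complement k m @ Z2) (complement k i @ Z)"
proof -
  let ?a = "lmul n" and ?L = "lists {1..<n}"
  have L: "Z1 \<in> ?L" "Z2 \<in> ?L" using monoid_cong_lists[OF eq] by auto
  \<comment> \<open>The hypothesis on words, restated as equations between classes that can be
    rewritten. The lengths are carried along because every further use has to stay below
    \<open>r\<close>.\<close>
  have lcm': "\<exists>Z \<in> ?L. braid n X = braid n (complement a b @ Z) \<and> braid n Y = braid n (complement b a @ Z)
      \<and> length X = length (complement a b @ Z) \<and> length Y = length (complement b a @ Z)"
    if "?a a (braid n X) = ?a b (braid n Y)" "X \<in> ?L" "Y \<in> ?L" "a \<in> {1..<n}" "b \<in> {1..<n}"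
      "length X < r" for a b X Y
  proof -
    have "braid_eq n (a # X) (b # Y)"
      using that braid_eq_iff[of "a # X" n "b # Y"] by (simp add: braid_Cons)
    then have "lcm_property n (a # X) (b # Y)" using lcm[of "a # X" "b # Y"] that by simp
    then obtain Z where Z: "braid_eq n X (complement a b @ Z)" "braid_eq n Y (complement b a @ Z)"
      by (auto simp: lcm_property_def)
    then show ?thesis
      using monoid_cong_lists(2)[OF Z(1)] braid_eq_iff[OF that(2)] braid_eq_iff[OF that(3)]
        braid_eq_invariant(1)[OF Z(1)] braid_eq_invariant(1)[OF Z(2)] by auto
  qed
  have E: "braid n (complement m i @ Z1) = braid n (complement m k @ Z2)"
    using eq braid_eq_iff[OF monoid_cong_lists(1)[OF eq]] by simp
  have len2: "length (complement m i @ Z1) = length (complement m k @ Z2)"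
    using braid_eq_invariant(1)[OF eq] .
  have goal: ?thesis if "Z \<in> ?L" "braid n (complement i m @ Z1) = braid n (complement i k @ Z)"
    "braid n (complement k m @ Z2) = braid n (complement k i @ Z)" for Z
  proof -
    have "complement a b \<in> ?L" if "a \<in> {1..<n}" "b \<in> {1..<n}" for a b
      using that by (auto simp: complement_def)
    then have "complement i m @ Z1 \<in> ?L" "complement k m @ Z2 \<in> ?L" using L in_range by auto
    then show ?thesis using that braid_eq_iff by blast
  qed
  \<comment> \<open>Cancelling a letter is the case of equal first letters, where the complements
    are empty.\<close>
  have canc: "braid n X = braid n Y"
    if "?a a (braid n X) = ?a a (braid n Y)" "X \<in> ?L" "Y \<in> ?L" "a \<in> {1..<n}" "length X < r" for a X Y
  proof -
    have "\<exists>Z. braid n X = braid n (complement a a @ Z) \<and> braid n Y = braid n (complement a a @ Z)"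
      using lcm'[OF that(1-4) that(4,5)] by blast
    then show ?thesis by auto
  qed
  have far: "\<exists>Z\<in>?L. braid n X = ?a b (braid n Z) \<and> braid n Y = ?a a (braid n Z)
      \<and> length X = Suc (length Z) \<and> length Y = Suc (length Z)"
    if "?a a (braid n X) = ?a b (braid n Y)" "X \<in> ?L" "Y \<in> ?L" "a \<in> {1..<n}" "b \<in> {1..<n}"
      "length X < r" "a \<noteq> b" "\<not> adjacent a b" for a b X Y
  proof -
    have "complement a b = [b]" "complement b a = [a]"
      using that by (simp_all add: complement_def adjacent_commute)
    then show ?thesis using lcm'[OF that(1-6)] by (simp only: braid_Cons append.simps list.size) simp
  qed
  have near: "\<exists>Z\<in>?L. braid n X = ?a b (?a a (braid n Z)) \<and> braid n Y = ?a a (?a b (braid n Z))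
      \<and> length X = Suc (Suc (length Z)) \<and> length Y = Suc (Suc (length Z))"
    if "?a a (braid n X) = ?a b (braid n Y)" "X \<in> ?L" "Y \<in> ?L" "a \<in> {1..<n}" "b \<in> {1..<n}"
      "length X < r" "adjacent a b" for a b X Y
  proof -
    have "complement a b = [b, a]" "complement b a = [a, b]"
      using that by (auto simp: complement_def adjacent_def)
    then show ?thesis using lcm'[OF that(1-6)] by (simp only: braid_Cons append.simps list.size) simp
  qed
  \<comment> \<open>The generators lie on a line, so three of them cannot be pairwise adjacent. For
    distinct letters this leaves seven of the eight adjacency patterns.\<close>
  have tri: "\<not> (adjacent i m \<and> adjacent m k \<and> adjacent i k)" by (auto simp: adjacent_def)
  have com: "?a a (?a b x) = ?a b (?a a x)"
    if "a \<in> {1..<n}" "b \<in> {1..<n}" "a \<noteq> b" "\<not> adjacent a b" for a b x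
    using lmul_commute[of a n b] that by simp
  have br: "?a a (?a b (?a a x)) = ?a b (?a a (?a b x))"
    if "a \<in> {1..<n}" "b \<in> {1..<n}" "adjacent a b" for a b x
    using lmul_braid[of a n b] that by simp
  consider "i = m" | "m = k" | "i = k" "i \<noteq> m"
    | "i \<noteq> m" "m \<noteq> k" "i \<noteq> k" "\<not> adjacent i m" "\<not> adjacent m k" "\<not> adjacent i k"
    | "i \<noteq> m" "m \<noteq> k" "i \<noteq> k" "adjacent i m" "\<not> adjacent m k" "\<not> adjacent i k"
    | "i \<noteq> m" "m \<noteq> k" "i \<noteq> k" "\<not> adjacent i m" "adjacent m k" "\<not> adjacent i k"
    | "i \<noteq> m" "m \<noteq> k" "i \<noteq> k" "\<not> adjacent i m" "\<not> adjacent m k" "adjacent i k"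
    | "i \<noteq> m" "m \<noteq> k" "i \<noteq> k" "adjacent i m" "adjacent m k" "\<not> adjacent i k"
    | "i \<noteq> m" "m \<noteq> k" "i \<noteq> k" "adjacent i m" "\<not> adjacent m k" "adjacent i k"
    | "i \<noteq> m" "m \<noteq> k" "i \<noteq> k" "\<not> adjacent i m" "adjacent m k" "adjacent i k"
    using tri by argo
  then show ?thesis
  proof cases
    case 1
    have "complement i m = []" "complement m i = []" using 1 by (auto simp: complement_def)
    then show ?thesis using goal[of Z2] E L(2) 1 by simp
  next
    case 2
    have "complement k m = []" "complement m k = []" using 2 by (auto simp: complement_def)
    then show ?thesis using goal[of Z1] E L(1) 2 by simp
  next
    case 3
    have "braid n Z1 = braid n Z2"
    proof (cases "adjacent i m")
      case True
      then have c: "complement m i = [i, m]"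
        using 3 adjacent_commute[of i m] by (simp add: complement_def)
      have "braid n (m # Z1) = braid n (m # Z2)"
        by (rule canc[of i]) (use E c 3 L in_range len in \<open>simp_all add: braid_Cons\<close>)
      then show ?thesis
        by (intro canc[of m]) (use c L in_range len in \<open>simp_all add: braid_Cons\<close>)
    next
      case False
      then have c: "complement m i = [i]"
        using 3 adjacent_commute[of i m] by (simp add: complement_def)
      show ?thesis
        by (rule canc[of i]) (use E c 3 L in_range len in \<open>simp_all add: braid_Cons\<close>)
    qed
    moreover have "complement i m \<in> ?L" using in_range by (auto simp: complement_def)
    moreover have "complement i m = [m] \<or> complement i m = [m, i]" "complement i k = []" "complement k i = []"
      using 3 by (auto simp: complement_def)
    ultimately show ?thesis using goal[of "complement i m @ Z1"] L(1) 3(1) by (auto simp: braid_Cons)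
  next
    \<comment> \<open>From here on the letters are distinct. In each case the leading letters of the
      witness complete \<open>i # complement i k\<close> to a reduced word of the longest element of
      the subgroup generated by the three transpositions, of length 3, 4 or 6. They are found by
      resolving the given equation with \<open>far\<close> and \<open>near\<close>.\<close>
    case 4
    then have c: "complement m i = [i]" "complement m k = [k]" "complement i m = [m]"
      "complement k m = [m]" "complement i k = [k]" "complement k i = [i]"
      by (simp_all add: complement_def adjacent_commute)
    have "\<exists>V\<in>?L. braid n Z1 = ?a k (braid n V) \<and> braid n Z2 = ?a i (braid n V)
        \<and> length Z1 = Suc (length V) \<and> length Z2 = Suc (length V)"
      by (rule far) (use E c L in_range len 4 in \<open>simp_all add: braid_Cons adjacent_commute\<close>)
    then obtain V where V: "V \<in> ?L" "braid n Z1 = ?a k (braid n V)" "braid n Z2 = ?a i (braid n V)"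
        "length Z1 = Suc (length V)" "length Z2 = Suc (length V)"
      by blast
    show ?thesis
    proof (rule goal[of "m # V"])
      show "braid n (complement i m @ Z1) = braid n (complement i k @ m # V)"
        using com[of m k] 4 in_range by (simp add: adjacent_commute c braid_Cons V)
      show "braid n (complement k m @ Z2) = braid n (complement k i @ m # V)"
        using com[of i m] 4 in_range by (simp add: adjacent_commute c braid_Cons V)
    qed (use V in_range in simp)
  next
    case 5
    then have c: "complement m i = [i, m]" "complement m k = [k]" "complement i m = [m, i]"
      "complement k m = [m]" "complement i k = [k]" "complement k i = [i]"
      by (simp_all add: complement_def adjacent_commute)
    have "\<exists>V\<in>?L. braid n (m # Z1) = ?a k (braid n V) \<and> braid n Z2 = ?a i (braid n V)
        \<and> length (m # Z1) = Suc (length V) \<and> length Z2 = Suc (length V)"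
      by (rule far) (use E c L in_range len 5 in \<open>simp_all add: braid_Cons adjacent_commute\<close>)
    then obtain V where V: "V \<in> ?L" "braid n (m # Z1) = ?a k (braid n V)" "braid n Z2 = ?a i (braid n V)"
        "length (m # Z1) = Suc (length V)" "length Z2 = Suc (length V)"
      by blast
    have "\<exists>U\<in>?L. braid n Z1 = ?a k (braid n U) \<and> braid n V = ?a m (braid n U)
        \<and> length Z1 = Suc (length U) \<and> length V = Suc (length U)"
      by (rule far) (use V c L in_range len 5 in \<open>simp_all add: braid_Cons adjacent_commute\<close>)
    then obtain U where U: "U \<in> ?L" "braid n Z1 = ?a k (braid n U)" "braid n V = ?a m (braid n U)"
        "length Z1 = Suc (length U)" "length V = Suc (length U)"
      by blast
    show ?thesis
    proof (rule goal[of "m # i # U"])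
      show "braid n (complement i m @ Z1) = braid n (complement i k @ m # i # U)"
        using com[of i k] com[of m k] 5 in_range by (simp add: adjacent_commute c braid_Cons U)
      show "braid n (complement k m @ Z2) = braid n (complement k i @ m # i # U)"
        using br[of i m] 5 in_range by (simp add: adjacent_commute c braid_Cons U V(3))
    qed (use U in_range in simp)
  next
    case 6
    then have c: "complement m i = [i]" "complement m k = [k, m]" "complement i m = [m]"
      "complement k m = [m, k]" "complement i k = [k]" "complement k i = [i]"
      by (simp_all add: complement_def adjacent_commute)
    have "\<exists>V\<in>?L. braid n Z1 = ?a k (braid n V) \<and> braid n (m # Z2) = ?a i (braid n V)
        \<and> length Z1 = Suc (length V) \<and> length (m # Z2) = Suc (length V)"
      by (rule far) (use E c L in_range len 6 in \<open>simp_all add: braid_Cons adjacent_commute\<close>)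
    then obtain V where V: "V \<in> ?L" "braid n Z1 = ?a k (braid n V)" "braid n (m # Z2) = ?a i (braid n V)"
        "length Z1 = Suc (length V)" "length (m # Z2) = Suc (length V)"
      by blast
    have "\<exists>U\<in>?L. braid n Z2 = ?a i (braid n U) \<and> braid n V = ?a m (braid n U)
        \<and> length Z2 = Suc (length U) \<and> length V = Suc (length U)"
      by (rule far) (use V c L in_range len len2 6 in \<open>simp_all add: braid_Cons adjacent_commute\<close>)
    then obtain U where U: "U \<in> ?L" "braid n Z2 = ?a i (braid n U)" "braid n V = ?a m (braid n U)"
        "length Z2 = Suc (length U)" "length V = Suc (length U)"
      by blast
    show ?thesis
    proof (rule goal[of "m # k # U"])
      show "braid n (complement i m @ Z1) = braid n (complement i k @ m # k # U)"
        using br[of m k] 6 in_range by (simp add: adjacent_commute c braid_Cons U V(2))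
      show "braid n (complement k m @ Z2) = braid n (complement k i @ m # k # U)"
        using com[of i k] com[of i m] 6 in_range by (simp add: adjacent_commute c braid_Cons U)
    qed (use U in_range in simp)
  next
    case 7
    then have c: "complement m i = [i]" "complement m k = [k]" "complement i m = [m]"
      "complement k m = [m]" "complement i k = [k, i]" "complement k i = [i, k]"
      by (simp_all add: complement_def adjacent_commute)
    have "\<exists>V\<in>?L. braid n Z1 = ?a k (?a i (braid n V)) \<and> braid n Z2 = ?a i (?a k (braid n V))
        \<and> length Z1 = Suc (Suc (length V)) \<and> length Z2 = Suc (Suc (length V))"
      by (rule near) (use E c L in_range len 7 in \<open>simp_all add: braid_Cons adjacent_commute\<close>)
    then obtain V where V: "V \<in> ?L" "braid n Z1 = ?a k (?a i (braid n V))" "braid n Z2 = ?a i (?a k (braid n V))"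
        "length Z1 = Suc (Suc (length V))" "length Z2 = Suc (Suc (length V))"
      by blast
    show ?thesis
    proof (rule goal[of "m # V"])
      show "braid n (complement i m @ Z1) = braid n (complement i k @ m # V)"
        using com[of m k] com[of m i] 7 in_range by (simp add: adjacent_commute c braid_Cons V)
      show "braid n (complement k m @ Z2) = braid n (complement k i @ m # V)"
        using com[of m k] com[of m i] 7 in_range by (simp add: adjacent_commute c braid_Cons V)
    qed (use V in_range in simp)
  next
    case 8
    then have c: "complement m i = [i, m]" "complement m k = [k, m]" "complement i m = [m, i]"
      "complement k m = [m, k]" "complement i k = [k]" "complement k i = [i]"
      by (simp_all add: complement_def adjacent_commute)
    have "\<exists>V\<in>?L. braid n (m # Z1) = ?a k (braid n V) \<and> braid n (m # Z2) = ?a i (braid n V)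
        \<and> length (m # Z1) = Suc (length V) \<and> length (m # Z2) = Suc (length V)"
      by (rule far) (use E c L in_range len 8 in \<open>simp_all add: braid_Cons adjacent_commute\<close>)
    then obtain V where V: "V \<in> ?L" "braid n (m # Z1) = ?a k (braid n V)" "braid n (m # Z2) = ?a i (braid n V)"
        "length (m # Z1) = Suc (length V)" "length (m # Z2) = Suc (length V)"
      by blast
    have "\<exists>U\<in>?L. braid n Z1 = ?a k (?a m (braid n U)) \<and> braid n V = ?a m (?a k (braid n U))
        \<and> length Z1 = Suc (Suc (length U)) \<and> length V = Suc (Suc (length U))"
      by (rule near) (use V c L in_range len 8 in \<open>simp_all add: braid_Cons adjacent_commute\<close>)
    then obtain U where U: "U \<in> ?L" "braid n Z1 = ?a k (?a m (braid n U))" "braid n V = ?a m (?a k (braid n U))"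
        "length Z1 = Suc (Suc (length U))" "length V = Suc (Suc (length U))"
      by blast
    have "\<exists>U'\<in>?L. braid n Z2 = ?a i (?a m (braid n U')) \<and> braid n V = ?a m (?a i (braid n U'))
        \<and> length Z2 = Suc (Suc (length U')) \<and> length V = Suc (Suc (length U'))"
      by (rule near) (use V c L in_range len 8 in \<open>simp_all add: braid_Cons adjacent_commute\<close>)
    then obtain U' where U': "U' \<in> ?L" "braid n Z2 = ?a i (?a m (braid n U'))" "braid n V = ?a m (?a i (braid n U'))"
        "length Z2 = Suc (Suc (length U'))" "length V = Suc (Suc (length U'))"
      by blast
    \<comment> \<open>\<open>V\<close> has been resolved in two ways, starting with
      \<open>m k\<close> and with \<open>m i\<close>. Cancelling \<open>m\<close> lets the two
      remainders be compared.\<close>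
    have "braid n (k # U) = braid n (i # U')"
      by (rule canc[of m]) (use U U' V len c in_range in \<open>simp_all add: braid_Cons\<close>)
    then have "\<exists>T\<in>?L. braid n U = ?a i (braid n T) \<and> braid n U' = ?a k (braid n T)
        \<and> length U = Suc (length T) \<and> length U' = Suc (length T)"
      by (intro far) (use U U' c L in_range len 8 in \<open>simp_all add: braid_Cons adjacent_commute\<close>)
    then obtain T where T: "T \<in> ?L" "braid n U = ?a i (braid n T)" "braid n U' = ?a k (braid n T)"
        "length U = Suc (length T)" "length U' = Suc (length T)"
      by blast
    have F: "?a i (?a k x) = ?a k (?a i x)" for x
      using com[of i k x] 8 in_range by (simp add: adjacent_commute)
    have B1: "?a i (?a m (?a i x)) = ?a m (?a i (?a m x))" for x
      using br[of i m x] 8 in_range by (simp add: adjacent_commute)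
    have B2: "?a k (?a m (?a k x)) = ?a m (?a k (?a m x))" for x
      using br[of k m x] 8 in_range by (simp add: adjacent_commute)
    show ?thesis
    proof (rule goal[of "m # k # i # m # T"])
      have "?a m (?a i (?a k (?a m (?a i x)))) = ?a k (?a m (?a k (?a i (?a m x))))" for x
      proof -
        have "?a m (?a i (?a k (?a m (?a i x)))) = ?a m (?a k (?a i (?a m (?a i x))))" by (metis F)
        also have "\<dots> = ?a m (?a k (?a m (?a i (?a m x))))" by (metis B1)
        also have "\<dots> = ?a k (?a m (?a k (?a i (?a m x))))" by (metis B2)
        finally show ?thesis .
      qed
      then show "braid n (complement i m @ Z1) = braid n (complement i k @ m # k # i # m # T)"
        by (simp add: c braid_Cons U T)
      have "?a m (?a k (?a i (?a m (?a k x)))) = ?a i (?a m (?a k (?a i (?a m x))))" for x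
      proof -
        have "?a m (?a k (?a i (?a m (?a k x)))) = ?a m (?a i (?a k (?a m (?a k x))))" by (metis F)
        also have "\<dots> = ?a m (?a i (?a m (?a k (?a m x))))" by (metis B2)
        also have "\<dots> = ?a i (?a m (?a i (?a k (?a m x))))" by (metis B1)
        also have "\<dots> = ?a i (?a m (?a k (?a i (?a m x))))" by (metis F)
        finally show ?thesis .
      qed
      then show "braid n (complement k m @ Z2) = braid n (complement k i @ m # k # i # m # T)"
        by (simp add: c braid_Cons U' T)
    qed (use T in_range in simp)
  next
    case 9
    then have c: "complement m i = [i, m]" "complement m k = [k]" "complement i m = [m, i]"
      "complement k m = [m]" "complement i k = [k, i]" "complement k i = [i, k]"
      by (simp_all add: complement_def adjacent_commute)
    have "\<exists>V\<in>?L. braid n (m # Z1) = ?a k (?a i (braid n V)) \<and> braid n Z2 = ?a i (?a k (braid n V))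
        \<and> length (m # Z1) = Suc (Suc (length V)) \<and> length Z2 = Suc (Suc (length V))"
      by (rule near) (use E c L in_range len 9 in \<open>simp_all add: braid_Cons adjacent_commute\<close>)
    then obtain V where V: "V \<in> ?L" "braid n (m # Z1) = ?a k (?a i (braid n V))" "braid n Z2 = ?a i (?a k (braid n V))"
        "length (m # Z1) = Suc (Suc (length V))" "length Z2 = Suc (Suc (length V))"
      by blast
    have "\<exists>U\<in>?L. braid n Z1 = ?a k (braid n U) \<and> braid n (i # V) = ?a m (braid n U)
        \<and> length Z1 = Suc (length U) \<and> length (i # V) = Suc (length U)"
      by (rule far) (use V c L in_range len 9 in \<open>simp_all add: braid_Cons adjacent_commute\<close>)
    then obtain U where U: "U \<in> ?L" "braid n Z1 = ?a k (braid n U)" "braid n (i # V) = ?a m (braid n U)"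
        "length Z1 = Suc (length U)" "length (i # V) = Suc (length U)"
      by blast
    have "\<exists>T\<in>?L. braid n V = ?a m (?a i (braid n T)) \<and> braid n U = ?a i (?a m (braid n T))
        \<and> length V = Suc (Suc (length T)) \<and> length U = Suc (Suc (length T))"
      by (rule near) (use V U c L in_range len 9 in \<open>simp_all add: braid_Cons adjacent_commute\<close>)
    then obtain T where T: "T \<in> ?L" "braid n V = ?a m (?a i (braid n T))" "braid n U = ?a i (?a m (braid n T))"
        "length V = Suc (Suc (length T))" "length U = Suc (Suc (length T))"
      by blast
    have F: "?a m (?a k x) = ?a k (?a m x)" for x
      using com[of m k x] 9 in_range by (simp add: adjacent_commute)
    have B1: "?a i (?a m (?a i x)) = ?a m (?a i (?a m x))" for x
      using br[of i m x] 9 in_range by (simp add: adjacent_commute)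
    have B2: "?a k (?a i (?a k x)) = ?a i (?a k (?a i x))" for x
      using br[of k i x] 9 in_range by (simp add: adjacent_commute)
    show ?thesis
    proof (rule goal[of "m # i # k # T"])
      have "?a m (?a i (?a k (?a i (?a m x)))) = ?a k (?a i (?a m (?a i (?a k x))))" for x
      proof -
        have "?a m (?a i (?a k (?a i (?a m x)))) = ?a m (?a k (?a i (?a k (?a m x))))" by (metis B2)
        also have "\<dots> = ?a k (?a m (?a i (?a k (?a m x))))" by (metis F)
        also have "\<dots> = ?a k (?a m (?a i (?a m (?a k x))))" by (metis F)
        also have "\<dots> = ?a k (?a i (?a m (?a i (?a k x))))" by (metis B1)
        finally show ?thesis .
      qed
      then show "braid n (complement i m @ Z1) = braid n (complement i k @ m # i # k # T)"
        by (simp add: c braid_Cons U T)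
      have "?a m (?a i (?a k (?a m (?a i x)))) = ?a i (?a k (?a m (?a i (?a k x))))" for x
      proof -
        have "?a m (?a i (?a k (?a m (?a i x)))) = ?a m (?a i (?a m (?a k (?a i x))))" by (metis F)
        also have "\<dots> = ?a i (?a m (?a i (?a k (?a i x))))" by (metis B1)
        also have "\<dots> = ?a i (?a m (?a k (?a i (?a k x))))" by (metis B2)
        also have "\<dots> = ?a i (?a k (?a m (?a i (?a k x))))" by (metis F)
        finally show ?thesis .
      qed
      then show "braid n (complement k m @ Z2) = braid n (complement k i @ m # i # k # T)"
        by (simp add: c braid_Cons V(3) T)
    qed (use T in_range in simp)
  next
    case 10
    then have c: "complement m i = [i]" "complement m k = [k, m]" "complement i m = [m]"
      "complement k m = [m, k]" "complement i k = [k, i]" "complement k i = [i, k]"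
      by (simp_all add: complement_def adjacent_commute)
    have "\<exists>V\<in>?L. braid n Z1 = ?a k (?a i (braid n V)) \<and> braid n (m # Z2) = ?a i (?a k (braid n V))
        \<and> length Z1 = Suc (Suc (length V)) \<and> length (m # Z2) = Suc (Suc (length V))"
      by (rule near) (use E c L in_range len 10 in \<open>simp_all add: braid_Cons adjacent_commute\<close>)
    then obtain V where V: "V \<in> ?L" "braid n Z1 = ?a k (?a i (braid n V))" "braid n (m # Z2) = ?a i (?a k (braid n V))"
        "length Z1 = Suc (Suc (length V))" "length (m # Z2) = Suc (Suc (length V))"
      by blast
    have "\<exists>U\<in>?L. braid n Z2 = ?a i (braid n U) \<and> braid n (k # V) = ?a m (braid n U)
        \<and> length Z2 = Suc (length U) \<and> length (k # V) = Suc (length U)"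
      by (rule far) (use V c L in_range len len2 10 in \<open>simp_all add: braid_Cons adjacent_commute\<close>)
    then obtain U where U: "U \<in> ?L" "braid n Z2 = ?a i (braid n U)" "braid n (k # V) = ?a m (braid n U)"
        "length Z2 = Suc (length U)" "length (k # V) = Suc (length U)"
      by blast
    have "\<exists>T\<in>?L. braid n V = ?a m (?a k (braid n T)) \<and> braid n U = ?a k (?a m (braid n T))
        \<and> length V = Suc (Suc (length T)) \<and> length U = Suc (Suc (length T))"
      by (rule near) (use V U c L in_range len 10 in \<open>simp_all add: braid_Cons adjacent_commute\<close>)
    then obtain T where T: "T \<in> ?L" "braid n V = ?a m (?a k (braid n T))" "braid n U = ?a k (?a m (braid n T))"
        "length V = Suc (Suc (length T))" "length U = Suc (Suc (length T))"
      by blast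
    have F: "?a m (?a i x) = ?a i (?a m x)" for x
      using com[of m i x] 10 in_range by (simp add: adjacent_commute)
    have B1: "?a k (?a m (?a k x)) = ?a m (?a k (?a m x))" for x
      using br[of k m x] 10 in_range by (simp add: adjacent_commute)
    have B2: "?a i (?a k (?a i x)) = ?a k (?a i (?a k x))" for x
      using br[of i k x] 10 in_range by (simp add: adjacent_commute)
    show ?thesis
    proof (rule goal[of "m # k # i # T"])
      have "?a m (?a k (?a i (?a m (?a k x)))) = ?a k (?a i (?a m (?a k (?a i x))))" for x
      proof -
        have "?a m (?a k (?a i (?a m (?a k x)))) = ?a m (?a k (?a m (?a i (?a k x))))" by (metis F)
        also have "\<dots> = ?a k (?a m (?a k (?a i (?a k x))))" by (metis B1)
        also have "\<dots> = ?a k (?a m (?a i (?a k (?a i x))))" by (metis B2)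
        also have "\<dots> = ?a k (?a i (?a m (?a k (?a i x))))" by (metis F)
        finally show ?thesis .
      qed
      then show "braid n (complement i m @ Z1) = braid n (complement i k @ m # k # i # T)"
        by (simp add: c braid_Cons V(2) T)
      have "?a m (?a k (?a i (?a k (?a m x)))) = ?a i (?a k (?a m (?a k (?a i x))))" for x
      proof -
        have "?a m (?a k (?a i (?a k (?a m x)))) = ?a m (?a i (?a k (?a i (?a m x))))" by (metis B2)
        also have "\<dots> = ?a i (?a m (?a k (?a i (?a m x))))" by (metis F)
        also have "\<dots> = ?a i (?a m (?a k (?a m (?a i x))))" by (metis F)
        also have "\<dots> = ?a i (?a k (?a m (?a k (?a i x))))" by (metis B1)
        finally show ?thesis .
      qed
      then show "braid n (complement k m @ Z2) = braid n (complement k i @ m # k # i # T)"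
        by (simp add: c braid_Cons U T)
    qed (use T in_range in simp)
  qed
qed

text \<open>Outer induction on a bound for the length, inner induction on the derivation of the
  congruence. Only transitivity is difficult: it yields two factorisations of the tail of the middle
  word, and the tail is one letter shorter, so the cube condition is available from the outer
  hypothesis.\<close>

lemma lcm_property:
  assumes "braid_eq n u v"
  shows "lcm_property n u v"
proof -
  have "lcm_property n u v" if "length u \<le> r" "braid_eq n u v" for r u v
    using that
  proof (induction r arbitrary: u v)
    case 0
    then show ?case by (simp add: lcm_property_def)
  next
    case (Suc r)
    from Suc.prems(2,1) show ?case
    proof (induction rule: monoid_cong.induct)
      case (refl w)
      then show ?case by (auto simp: lcm_property_def complement_def intro!: exI monoid_cong.refl)
    next
      case (rel u v x y)
      then show ?case
      proof (cases x)
        case Nil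
        \<comment> \<open>Every defining relation equates \<open>i # complement i j\<close> with
          \<open>j # complement j i\<close>, so the remainder is \<open>y\<close>.\<close>
        from rel(1) obtain i j where "u = i # complement i j" "v = j # complement j i"
        proof (cases rule: braid_relations_cases)
          case (near i)
          then show ?thesis using that[of i "Suc i"] by (simp add: complement_def adjacent_def)
        next
          case (far i j)
          then have "i \<noteq> j" "\<not> adjacent i j" "\<not> adjacent j i" by (auto simp: adjacent_def)
          then show ?thesis using that[of i j] far(4,5) by (simp add: complement_def)
        qed
        moreover have "braid_eq n (complement i j @ y) (complement i j @ y)"
          "braid_eq n (complement j i @ y) (complement j i @ y)"
          using calculation rel by (auto intro!: monoid_cong.refl)
        ultimately show ?thesis using Nil unfolding lcm_property_def by auto
      next
        case (Cons a x')
        have "braid_eq n (x' @ u @ y) (x' @ v @ y)"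
          using rel Cons by (intro monoid_cong.rel) auto
        moreover have "braid_eq n (x' @ v @ y) (x' @ v @ y)"
          using rel Cons by (intro monoid_cong.refl) auto
        ultimately show ?thesis using Cons by (auto simp: lcm_property_def complement_def)
      qed
    next
      case (sym u v)
      then show ?case using braid_eq_invariant(1)[OF sym(1)] by (auto simp: lcm_property_def)
    next
      case (trans u v w)
      have len: "length u = length v" "length v = length w"
        using trans(1,2)[THEN braid_eq_invariant(1)] by auto
      show ?case
        unfolding lcm_property_def
      proof (intro allI impI)
        fix i X k Y assume u: "u = i # X" and w: "w = k # Y"
        then obtain m W where v: "v = m # W" using len by (cases v) auto
        have range: "i \<in> {1..<n}" "m \<in> {1..<n}" "k \<in> {1..<n}"
          using monoid_cong_lists[OF trans(1)] monoid_cong_lists[OF trans(2)] u v w by auto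
        obtain Z1 where Z1: "braid_eq n X (complement i m @ Z1)" "braid_eq n W (complement m i @ Z1)"
          using trans u v unfolding lcm_property_def by blast
        obtain Z2 where Z2: "braid_eq n W (complement m k @ Z2)" "braid_eq n Y (complement k m @ Z2)"
          using trans v w len unfolding lcm_property_def by auto
        have "length (complement m i @ Z1) \<le> r"
          using braid_eq_invariant(1)[OF Z1(2)] trans.prems len v by simp
        then obtain Z where "braid_eq n (complement i m @ Z1) (complement i k @ Z)"
            "braid_eq n (complement k m @ Z2) (complement k i @ Z)"
          using complement_cube[OF Suc.IH range, where ?Z1.0 = Z1 and ?Z2.0 = Z2] Z1(2) Z2(1)
          by (meson monoid_cong.sym monoid_cong.trans)
        then show "\<exists>Z. braid_eq n X (complement i k @ Z) \<and> braid_eq n Y (complement k i @ Z)"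
          using Z1(1) Z2(2) by (meson monoid_cong.trans)
      qed
    qed
  qed
  then show ?thesis using assms by blast
qed

lemma braid_eq_lcm:
  assumes "braid_eq n (i # X) (j # Y)"
  obtains Z where "braid_eq n X (complement i j @ Z)" "braid_eq n Y (complement j i @ Z)"
  using lcm_property[OF assms] by (auto simp: lcm_property_def)

lemma braid_eq_cancel:
  assumes "braid_eq n (u @ X) (u @ Y)"
  shows "braid_eq n X Y"
  using assms
proof (induction u)
  case (Cons i u)
  obtain Z where "braid_eq n (u @ X) (complement i i @ Z)" "braid_eq n (u @ Y) (complement i i @ Z)"
    using braid_eq_lcm[OF Cons.prems[unfolded append_Cons]] by blast
  then have "braid_eq n (u @ X) (u @ Y)" by (meson monoid_cong.sym monoid_cong.trans)
  then show ?case by (rule Cons.IH)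
qed simp

section \<open>Reduced words\<close>

lemma word_perm_permutes: "w \<in> lists {1..<n} \<Longrightarrow> word_perm w permutes {1..n}"
proof (induction w)
  case (Cons i w)
  then show ?case
    using permutes_compose[OF adjacent_transpose_permutes[of i n], of "word_perm w"]
    by (simp del: comp_apply id_apply)
qed (simp add: permutes_id del: comp_apply id_apply)

lemma word_perm_rev: "inv' (word_perm w) = word_perm (rev w)"
proof (rule inv_unique_comp)
  show "word_perm w \<circ> word_perm (rev w) = id"
  proof (induction w)
    case (Cons i w)
    have "word_perm (i # w) \<circ> word_perm (rev (i # w)) =
        word_perm w \<circ> (transpose i (Suc i) \<circ> transpose i (Suc i)) \<circ> word_perm (rev w)"
      by (simp only: word_perm_append rev.simps word_perm_Cons word_perm.simps(1) id_comp comp_assoc)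
    then show ?case using Cons by (simp del: comp_apply id_apply)
  qed simp
  show "word_perm (rev w) \<circ> word_perm w = id"
  proof (induction w rule: rev_induct)
    case (snoc i w)
    have "word_perm (rev (w @ [i])) \<circ> word_perm (w @ [i]) =
        word_perm (rev w) \<circ> (transpose i (Suc i) \<circ> transpose i (Suc i)) \<circ> word_perm w"
      by (simp only: word_perm_append rev_append rev.simps append.simps word_perm_Cons word_perm.simps(1) id_comp comp_assoc)
    then show ?case using snoc by (simp del: comp_apply id_apply)
  qed simp
qed

text \<open>These are the words of minimal length for their permutation, since the inversion number
  is the Coxeter length. In terms of inversions the notion can be tested letter by letter.\<close>

definition reduced :: "nat \<Rightarrow> nat list \<Rightarrow> bool" where
  "reduced n w \<longleftrightarrow> w \<in> lists {1..<n} \<and> inv_count n (word_perm w) = length w"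

lemma inv_count_word_perm_le: "w \<in> lists {1..<n} \<Longrightarrow> inv_count n (word_perm w) \<le> length w"
proof (induction w)
  case (Cons i w)
  then have i: "i \<in> {1..<n}" and w: "w \<in> lists {1..<n}" by auto
  show ?case
  proof (cases rule: permutes_adjacent_cases[OF word_perm_permutes[OF w], of i])
    case 1
    then show ?thesis
      using inv_count_comp_transpose_ascent[of i n "word_perm w", OF i 1] Cons.IH[OF w]
      by (simp del: comp_apply id_apply)
  next
    case 2
    then show ?thesis
      using inv_count_comp_transpose_descent[of i n "word_perm w", OF i 2] Cons.IH[OF w]
      by (simp del: comp_apply id_apply)
  qed
qed simp

text \<open>A letter put in front changes the inversion number by exactly one, upwards at an ascent
  and downwards at a descent; after a step downwards the word is too long.\<close>

lemma reduced_Cons: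
  assumes "i \<in> {1..<n}"
  shows "reduced n (i # w) \<longleftrightarrow> reduced n w \<and> word_perm w i < word_perm w (Suc i)"
proof (cases "w \<in> lists {1..<n}")
  case True
  show ?thesis
  proof (cases rule: permutes_adjacent_cases[OF word_perm_permutes[OF True], of i])
    case 1
    then show ?thesis
      using True assms inv_count_comp_transpose_ascent[of i n "word_perm w", OF assms 1] by (auto simp: reduced_def)
  next
    case 2
    then show ?thesis
      using True assms inv_count_comp_transpose_descent[of i n "word_perm w", OF assms 2] inv_count_word_perm_le[OF True]
      by (auto simp: reduced_def)
  qed
qed (auto simp: reduced_def)

lemma reduced_Nil [simp]: "reduced n []"
  by (simp add: reduced_def)

lemma reduced_lists: "reduced n w \<Longrightarrow> w \<in> lists {1..<n}"
  by (simp add: reduced_def)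

text \<open>Reversal inverts the permutation, and a permutation has as many inversions as its
  inverse. This carries facts about first letters over to last letters.\<close>

lemma reduced_rev [simp]: "reduced n (rev w) \<longleftrightarrow> reduced n w"
proof (cases "w \<in> lists {1..<n}")
  case True
  then show ?thesis
    using inv_count_inv[OF word_perm_permutes[OF True]] by (auto simp: reduced_def word_perm_rev)
qed (auto simp: reduced_def)

lemma reduced_snoc:
  assumes "i \<in> {1..<n}"
  shows "reduced n (w @ [i]) \<longleftrightarrow>
    reduced n w \<and> inv' (word_perm w) i < inv' (word_perm w) (Suc i)"
  using reduced_Cons[OF assms, of "rev w"] reduced_rev[of n "w @ [i]"] by (simp add: word_perm_rev)

lemma reduced_ConsD: "reduced n (i # w) \<Longrightarrow> reduced n w"
  using reduced_Cons[of i n w] reduced_lists[of n "i # w"] by auto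

lemma reduced_appendD2: "reduced n (u @ v) \<Longrightarrow> reduced n v"
  by (induction u) (auto dest: reduced_ConsD)

lemma reduced_appendD1: "reduced n (u @ v) \<Longrightarrow> reduced n u"
  using reduced_appendD2[of n "rev v" "rev u"] reduced_rev[of n "u @ v"] by simp

lemma braid_eq_reduced: "braid_eq n u v \<Longrightarrow> reduced n u \<longleftrightarrow> reduced n v"
  using braid_eq_invariant[of u v n] monoid_cong_lists[of u v "{1..<n}"] by (auto simp: reduced_def)

lemma reduced_Cons_perm:
  assumes "reduced n w" "word_perm w = p \<circ> transpose i (Suc i)" "i \<in> descents n p"
  shows "reduced n (i # w) \<and> word_perm (i # w) = p"
  using assms reduced_Cons[of i n w] by (auto simp: descents_def)

lemma descents_word_perm_Cons:
  assumes "reduced n (i # w)"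
  shows "i \<in> descents n (word_perm (i # w))"
  using assms reduced_lists[OF assms] reduced_Cons[of i n w] by (auto simp: descents_def)

lemma ex_reduced:
  assumes "p permutes {1..n}"
  shows "\<exists>w. reduced n w \<and> word_perm w = p"
  using assms
proof (induction "inv_count n p" arbitrary: p rule: less_induct)
  case less
  show ?case
  proof (cases "descents n p = {}")
    case True
    then have "p i < p (Suc i)" if "i \<in> {1..<n}" for i
      using permutes_adjacent_cases[OF less.prems, of i] that by (auto simp: descents_def)
    then have "p = id" using permutes_eq_id_if_no_descents[OF less.prems] by blast
    then show ?thesis by (intro exI[of _ "[]"]) simp
  next
    case False
    then obtain i where i: "i \<in> descents n p" by blast
    then have i': "i \<in> {1..<n}" "p (Suc i) < p i" by (auto simp: descents_def)
    have "inv_count n (p \<circ> transpose i (Suc i)) < inv_count n p"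
      using inv_count_comp_transpose_descent[of i n p, OF i'] by simp
    moreover have "(p \<circ> transpose i (Suc i)) permutes {1..n}"
      using permutes_compose[OF adjacent_transpose_permutes[OF i'(1)] less.prems] .
    ultimately obtain w where "reduced n w" "word_perm w = p \<circ> transpose i (Suc i)"
      using less.hyps by blast
    then show ?thesis using reduced_Cons_perm i by blast
  qed
qed

lemma braid_eq_Cons: "braid_eq n u v \<Longrightarrow> i \<in> {1..<n} \<Longrightarrow> braid_eq n (i # u) (i # v)"
  using monoid_cong_append_left[of u v "{1..<n}" "braid_relations n" "[i]"] by simp

lemma complement_in_lists:
  "i \<in> {1..<n} \<Longrightarrow> j \<in> {1..<n} \<Longrightarrow> complement i j \<in> lists {1..<n}"
  by (auto simp: complement_def)

lemma braid_eq_complement: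
  assumes "i \<in> {1..<n}" "j \<in> {1..<n}" "Z \<in> lists {1..<n}"
  shows "braid_eq n (i # complement i j @ Z) (j # complement j i @ Z)"
proof -
  have "braid n (i # complement i j @ Z) = braid n (j # complement j i @ Z)"
    using lmul_commute[OF assms(1,2)] lmul_braid[OF assms(1,2)] adjacent_commute[of i j]
    by (simp add: complement_def braid_Cons)
  then show ?thesis
    using assms complement_in_lists[OF assms(1,2)] by (subst (asm) braid_eq_iff) auto
qed

lemma descents_comp_transpose_far:
  assumes "i \<in> descents n p" "j \<in> descents n p" "i \<noteq> j" "\<not> adjacent i j"
  shows "j \<in> descents n (p \<circ> transpose i (Suc i))"
  using assms by (auto simp: descents_def transpose_def adjacent_def)

lemma descents_comp_transpose_adjacent:
  assumes "i \<in> descents n p" "j \<in> descents n p" "adjacent i j"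
  shows "j \<in> descents n (p \<circ> transpose i (Suc i))"
    "i \<in> descents n (p \<circ> transpose i (Suc i) \<circ> transpose j (Suc j))"
  using assms by (auto simp: descents_def transpose_def adjacent_def)

text \<open>The counterpart of \<open>lcm_property\<close> for permutations: the letters of
  \<open>i # complement i j\<close> are stripped off at successive descents, and what is left has a
  reduced word.\<close>

lemma ex_reduced_complement:
  assumes "p permutes {1..n}" "i \<in> descents n p" "j \<in> descents n p" "i \<noteq> j"
  shows "\<exists>Z. reduced n (i # complement i j @ Z) \<and> word_perm (i # complement i j @ Z) = p"
proof -
  let ?t = "\<lambda>i. transpose i (Suc i)"
  have t: "?t i permutes {1..n}" "?t j permutes {1..n}"
    using assms adjacent_transpose_permutes by (auto simp: descents_def)
  show ?thesis
  proof (cases "adjacent i j")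
    case True
    have "(p \<circ> ?t i \<circ> ?t j \<circ> ?t i) permutes {1..n}"
      using assms(1) t by (intro permutes_compose)
    then obtain Z where Z: "reduced n Z" "word_perm Z = p \<circ> ?t i \<circ> ?t j \<circ> ?t i"
      using ex_reduced by blast
    note d = descents_comp_transpose_adjacent[OF assms(2,3) True]
    have 1: "reduced n (i # Z)" "word_perm (i # Z) = p \<circ> ?t i \<circ> ?t j"
      using reduced_Cons_perm[OF Z d(2)] by blast+
    have 2: "reduced n (j # i # Z)" "word_perm (j # i # Z) = p \<circ> ?t i"
      using reduced_Cons_perm[OF 1 d(1)] by blast+
    have "reduced n (i # j # i # Z) \<and> word_perm (i # j # i # Z) = p"
      by (rule reduced_Cons_perm[OF 2 assms(2)])
    then show ?thesis using True assms(4) by (auto simp: complement_def)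
  next
    case False
    have "(p \<circ> ?t i \<circ> ?t j) permutes {1..n}"
      using assms(1) t by (intro permutes_compose)
    then obtain Z where Z: "reduced n Z" "word_perm Z = p \<circ> ?t i \<circ> ?t j"
      using ex_reduced by blast
    have 1: "reduced n (j # Z)" "word_perm (j # Z) = p \<circ> ?t i"
      using reduced_Cons_perm[OF Z descents_comp_transpose_far[OF assms(2-4) False]] by blast+
    have "reduced n (i # j # Z) \<and> word_perm (i # j # Z) = p"
      by (rule reduced_Cons_perm[OF 1 assms(2)])
    then show ?thesis using False assms(4) by (auto simp: complement_def)
  qed
qed

lemma reduced_length: "reduced n w \<Longrightarrow> length w = inv_count n (word_perm w)"
  by (simp add: reduced_def)

lemma word_perm_Cons_cancel:
  assumes "word_perm (k # x) = word_perm (k # y)"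
  shows "word_perm x = word_perm y"
proof -
  have "word_perm x \<circ> transpose k (Suc k) \<circ> transpose k (Suc k) =
      word_perm y \<circ> transpose k (Suc k) \<circ> transpose k (Suc k)"
    using assms by (simp only: word_perm_Cons)
  then show ?thesis by (simp only: comp_transpose_transpose)
qed

text \<open>If the first letters differ, both are descents of the common permutation, which then has
  reduced words beginning with either of them that differ by a single braid relation. Each given
  word shares its first letter with one of these and is reached by induction.\<close>

theorem matsumoto:
  assumes "reduced n u" "reduced n v" "word_perm u = word_perm v"
  shows "braid_eq n u v"
  using assms
proof (induction "length u" arbitrary: u v)
  case 0
  then have "length u = length v" using reduced_length by metis
  then have "u = []" "v = []" using 0 by simp_all
  then show ?case by (simp add: monoid_cong.refl)
next
  case (Suc l)
  have len: "length u = length v" 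
    using reduced_length[OF Suc.prems(1)] reduced_length[OF Suc.prems(2)] Suc.prems(3) by simp
  obtain i u' where u: "u = i # u'" using Suc.hyps(2) by (cases u) auto
  obtain j v' where v: "v = j # v'" using Suc.hyps(2) len by (cases v) auto
  have ij: "i \<in> {1..<n}" "j \<in> {1..<n}" using reduced_lists Suc.prems u v by fastforce+
  have IH: "braid_eq n (k # x) (k # y)"
    if "reduced n (k # x)" "reduced n (k # y)" "word_perm (k # x) = word_perm (k # y)"
      "length (k # x) = Suc l" for k x y
  proof -
    have "k \<in> {1..<n}" using reduced_lists[OF that(1)] by simp
    moreover have "braid_eq n x y"
      by (rule Suc.hyps(1)[OF _ reduced_ConsD[OF that(1)] reduced_ConsD[OF that(2)]
            word_perm_Cons_cancel[OF that(3)]]) (use that(4) in simp)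
    ultimately show ?thesis by (rule braid_eq_Cons[rotated])
  qed
  show ?case
  proof (cases "i = j")
    case True
    show ?thesis
      unfolding u v True
      by (rule IH) (use Suc.prems Suc.hyps(2) u v True in \<open>simp_all only:\<close>)
  next
    case False
    let ?p = "word_perm u"
    have p: "?p permutes {1..n}" using word_perm_permutes reduced_lists Suc.prems(1) by blast
    have "i \<in> descents n ?p" "j \<in> descents n ?p"
      using descents_word_perm_Cons[of n i u'] descents_word_perm_Cons[of n j v'] Suc.prems
      unfolding u v by simp_all
    then obtain Z where Z: "reduced n (i # complement i j @ Z)" "word_perm (i # complement i j @ Z) = ?p"
      using ex_reduced_complement[OF p _ _ False] by blast
    have "Z \<in> lists {1..<n}" using reduced_lists[OF Z(1)] by simp
    then have e: "braid_eq n (i # complement i j @ Z) (j # complement j i @ Z)"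
      using braid_eq_complement ij by blast
    have "braid_eq n u (i # complement i j @ Z)"
      unfolding u by (rule IH[OF _ Z(1)]) (use Suc.prems(1) Suc.hyps(2) Z(2) u in \<open>simp_all only:\<close>)
    moreover have "braid_eq n v (j # complement j i @ Z)"
      unfolding v
      by (rule IH) (use Suc.prems Suc.hyps(2) Z v len braid_eq_reduced[OF e]
          braid_eq_invariant(2)[OF e] in \<open>simp_all only:\<close>)
    ultimately show ?thesis using e by (meson monoid_cong.sym monoid_cong.trans)
  qed
qed

lemma ex_Cons_if_descent:
  assumes "reduced n w" "i \<in> descents n (word_perm w)"
  shows "\<exists>z. braid_eq n (i # z) w"
proof -
  have i: "i \<in> {1..<n}" using assms(2) by (simp add: descents_def)
  have "word_perm w permutes {1..n}" using word_perm_permutes reduced_lists assms(1) by blast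
  then obtain z where "reduced n z" "word_perm z = word_perm w \<circ> transpose i (Suc i)"
    using ex_reduced permutes_compose[OF adjacent_transpose_permutes[OF i]] by blast
  then show ?thesis using reduced_Cons_perm assms matsumoto by metis
qed

lemma descents_if_braid_eq_Cons:
  assumes "reduced n w" "braid_eq n (i # z) w"
  shows "i \<in> descents n (word_perm w)"
  using assms braid_eq_reduced[OF assms(2)] braid_eq_invariant(2)[OF assms(2)]
    descents_word_perm_Cons by metis

section \<open>The Garside element\<close>

definition longest_perm :: "nat \<Rightarrow> nat \<Rightarrow> nat" where
  "longest_perm n x = (if x \<in> {1..n} then n + 1 - x else x)"

lemma longest_perm_permutes: "longest_perm n permutes {1..n}"
  by (rule bij_imp_permutes, rule bij_betwI[where g = "longest_perm n"])
    (auto simp: longest_perm_def)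

lemma longest_inv': "inv' (longest_perm n) = longest_perm n"
  by (rule inv_unique_comp) (auto simp: longest_perm_def fun_eq_iff)

lemma descents_longest_perm: "descents n (longest_perm n) = {1..<n}"
  by (auto simp: descents_def longest_perm_def)

lemma eq_longest_perm:
  assumes "p permutes {1..n}" "descents n p = {1..<n}"
  shows "p = longest_perm n"
proof (rule permutes_eq_if_all_descents[OF assms(1) _ longest_perm_permutes])
  show "p (Suc i) < p i" "longest_perm n (Suc i) < longest_perm n i" if "i \<in> {1..<n}" for i
    using assms(2) descents_longest_perm[of n] that unfolding descents_def by blast+
qed

section \<open>Left divisibility on words\<close>

definition braid_ldvd :: "nat \<Rightarrow> nat list \<Rightarrow> nat list \<Rightarrow> bool" where
  "braid_ldvd n u v \<longleftrightarrow> (\<exists>z. braid_eq n (u @ z) v)"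

lemma braid_ldvd_append_left: "braid_ldvd n (u @ v) y \<Longrightarrow> braid_ldvd n u y"
  by (auto simp: braid_ldvd_def)

lemma braid_ldvd_cong:
  assumes "braid_ldvd n u y" "braid_eq n u v"
  shows "braid_ldvd n v y"
proof -
  obtain z where z: "braid_eq n (u @ z) y" using assms(1) by (auto simp: braid_ldvd_def)
  then have "z \<in> lists {1..<n}" using monoid_cong_lists(1)[OF z] by auto
  then have "braid_eq n (v @ z) (u @ z)"
    using monoid_cong_append_right[OF assms(2)] monoid_cong.sym by blast
  then show ?thesis unfolding braid_ldvd_def using monoid_cong.trans[OF _ z] by blast
qed

lemma braid_ldvd_trans:
  assumes "braid_ldvd n u v" "braid_ldvd n v w"
  shows "braid_ldvd n u w"
  using assms braid_ldvd_cong[of n v w] braid_ldvd_append_left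
  by (metis braid_ldvd_def monoid_cong.sym)

lemma braid_ldvd_length: "braid_ldvd n u v \<Longrightarrow> length u \<le> length v"
proof -
  assume "braid_ldvd n u v"
  then obtain z where "braid_eq n (u @ z) v" by (auto simp: braid_ldvd_def)
  then have "length (u @ z) = length v" by (rule braid_eq_invariant)
  then show ?thesis by simp
qed

text \<open>Read backwards, \<open>s\<close> and \<open>t\<close> become ascents of the permutation
  of \<open>rev u\<close>, so the remaining letters can be prepended one at a time.\<close>

lemma reduced_append_complement:
  assumes "reduced n (u @ [s])" "reduced n (u @ [t])" "s \<noteq> t"
  shows "reduced n (u @ s # complement s t)"
proof -
  have st: "s \<in> {1..<n}" "t \<in> {1..<n}"
    using reduced_lists[OF assms(1)] reduced_lists[OF assms(2)] by auto
  let ?q = "word_perm (rev u)"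
  have q: "reduced n (rev u)" "?q s < ?q (Suc s)" "?q t < ?q (Suc t)"
    using assms reduced_rev[of n "u @ [s]"] reduced_rev[of n "u @ [t]"] reduced_Cons st by auto
  have "reduced n (rev (u @ s # complement s t))"
  proof (cases "adjacent s t")
    case True
    then have "reduced n (s # t # s # rev u)"
      using q st by (auto simp: reduced_Cons adjacent_def transpose_def)
    then show ?thesis using True assms(3) by (simp add: complement_def)
  next
    case False
    then have "reduced n (t # s # rev u)"
      using q st assms(3) by (auto simp: reduced_Cons adjacent_def transpose_def)
    then show ?thesis using False assms(3) by (simp add: complement_def)
  qed
  then show ?thesis by (simp only: reduced_rev)
qed

text \<open>The argument is due to Michel: take a reduced divisor \<open>g\<close> of \<open>y\<close> of maximal length, and a
  common divisor \<open>u\<close> of maximal length which has a reduced extension \<open>u @ [s]\<close> dividing \<open>y\<close> but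
  not \<open>g\<close>. Extending \<open>u\<close> within \<open>g\<close> by a letter \<open>t\<close> and completing to the least common multiple
  of \<open>s\<close> and \<open>t\<close> produces a longer such \<open>u\<close>.\<close>

lemma longest_ldvd:
  assumes "reduced n d" "descents n (word_perm d) = {1..<n}"
    and y: "y \<in> lists {1..<n}" "\<And>i. i \<in> {1..<n} \<Longrightarrow> braid_ldvd n [i] y"
  shows "braid_ldvd n d y"
proof -
  have "braid_ldvd n [] y" using monoid_cong.refl[OF y(1)] by (auto simp: braid_ldvd_def)
  moreover have "\<forall>w. reduced n w \<and> braid_ldvd n w y \<longrightarrow> length w < Suc (length y)"
    using braid_ldvd_length less_Suc_eq_le by blast
  ultimately obtain g where g: "reduced n g" "braid_ldvd n g y"
    and g_max: "\<And>w. reduced n w \<Longrightarrow> braid_ldvd n w y \<Longrightarrow> length w \<le> length g"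
    using ex_has_greatest_nat[of "\<lambda>w. reduced n w \<and> braid_ldvd n w y" "[]" length "Suc (length y)"]
      reduced_Nil by blast
  define P where "P u \<longleftrightarrow> braid_ldvd n u g \<and> (\<exists>s. reduced n (u @ [s]) \<and> braid_ldvd n (u @ [s]) y
    \<and> \<not> braid_ldvd n (u @ [s]) g)" for u
  have no_P: "\<not> P u" for u
  proof
    assume "P u"
    moreover have "\<forall>w. P w \<longrightarrow> length w < Suc (length g)"
      using braid_ldvd_length less_Suc_eq_le unfolding P_def by blast
    ultimately obtain u where "P u" and u_max: "\<And>v. P v \<Longrightarrow> length v \<le> length u"
      using ex_has_greatest_nat[of P u length "Suc (length g)"] by blast
    then obtain s where u: "braid_ldvd n u g"
      and s: "reduced n (u @ [s])" "braid_ldvd n (u @ [s]) y" "\<not> braid_ldvd n (u @ [s]) g"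
      by (auto simp: P_def)
    obtain v where v: "braid_eq n (u @ v) g" using u by (auto simp: braid_ldvd_def)
    \<comment> \<open>Otherwise \<open>u\<close> would be as long as \<open>g\<close>, and
      \<open>u @ [s]\<close> a reduced divisor of \<open>y\<close> longer than
      \<open>g\<close>.\<close>
    have "v \<noteq> []"
      using g_max[OF s(1,2)] braid_eq_invariant(1)[OF v] by auto
    then obtain t v' where v': "v = t # v'" by (cases v) auto
    have t: "braid_ldvd n (u @ [t]) g" using v v' by (auto simp: braid_ldvd_def)
    have "s \<noteq> t" using t s(3) by auto
    have "reduced n ((u @ [t]) @ v')" using braid_eq_reduced[OF v] g(1) v' by simp
    then have rt: "reduced n (u @ [t])" by (rule reduced_appendD1)
    obtain z1 where z1: "braid_eq n ((u @ [s]) @ z1) y" using s(2) by (auto simp: braid_ldvd_def)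
    obtain z2 where z2: "braid_eq n ((u @ [t]) @ z2) y"
      using braid_ldvd_trans[OF t g(2)] by (auto simp: braid_ldvd_def)
    have "braid_eq n (u @ s # z1) (u @ t # z2)"
      using z1 z2 monoid_cong.sym monoid_cong.trans by fastforce
    then have "braid_eq n (s # z1) (t # z2)" by (rule braid_eq_cancel)
    then obtain Z where Z: "braid_eq n z1 (complement s t @ Z)"
      by (rule braid_eq_lcm)
    let ?A = "u @ s # complement s t" and ?B = "u @ t # complement t s"
    have st: "s \<in> {1..<n}" "t \<in> {1..<n}" and ul: "u \<in> lists {1..<n}"
      using reduced_lists[OF s(1)] reduced_lists[OF rt] by auto
    have "braid_eq n (u @ s # z1) (u @ s # complement s t @ Z)"
      using monoid_cong_append_left[OF braid_eq_Cons[OF Z st(1)] ul] .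
    then have "braid_eq n (?A @ Z) y"
      using z1 monoid_cong.sym monoid_cong.trans by fastforce
    then have A: "braid_ldvd n ?A y" by (auto simp: braid_ldvd_def)
    have AB: "braid_eq n ?A ?B"
      using monoid_cong_append_left[OF braid_eq_complement[OF st, of "[]"] ul] by simp
    have B: "braid_ldvd n ?B y" "reduced n ?B"
      using braid_ldvd_cong[OF A AB] braid_eq_reduced[OF AB]
        reduced_append_complement[OF s(1) rt \<open>s \<noteq> t\<close>] by auto
    have nB: "\<not> braid_ldvd n ?B g"
      using braid_ldvd_cong[OF _ monoid_cong.sym[OF AB]] braid_ldvd_append_left[of n "u @ [s]"] s(3)
      by fastforce
    have "\<exists>c. complement t s = s # c \<and> (c = [] \<or> c = [t])"
      using \<open>s \<noteq> t\<close> by (cases "adjacent t s") (simp_all add: complement_def)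
    then obtain c where c: "complement t s = s # c" "c = [] \<or> c = [t]" by blast
    \<comment> \<open>\<open>?B\<close> divides \<open>y\<close> but not \<open>g\<close>, whereas
      \<open>u @ [t]\<close> divides \<open>g\<close>. Between the two, divisibility of
      \<open>g\<close> is lost at some letter, and the prefix before that letter contradicts the
      choice of \<open>u\<close>.\<close>
    show False
    proof (cases "braid_ldvd n (u @ [t, s]) g")
      case False
      moreover have "reduced n (u @ [t, s])" "braid_ldvd n (u @ [t, s]) y"
        using reduced_appendD1[of n "u @ [t, s]" c] braid_ldvd_append_left[of n "u @ [t, s]" c] B c
        by auto
      ultimately have "P (u @ [t])" using t by (auto simp: P_def)
      then show False using u_max by fastforce
    next
      case True
      then have "c = [t]" using c nB by auto
      then have "P (u @ [t, s])" using True B nB c by (auto simp: P_def)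
      then show False using u_max by fastforce
    qed
  qed
  \<comment> \<open>Since \<open>P []\<close> fails, every letter divides \<open>g\<close>; all
    positions are then descents, and \<open>g\<close> is a word of the longest permutation.\<close>
  have "i \<in> descents n (word_perm g)" if i: "i \<in> {1..<n}" for i
  proof -
    have "reduced n [i]" using reduced_Cons[OF i, of "[]"] by simp
    moreover have "braid_ldvd n [] g"
      using monoid_cong.refl[OF reduced_lists[OF g(1)]] by (auto simp: braid_ldvd_def)
    ultimately have "braid_ldvd n [i] g" using no_P[of "[]"] y(2)[OF i] by (auto simp: P_def)
    then show ?thesis using descents_if_braid_eq_Cons[OF g(1)] by (auto simp: braid_ldvd_def)
  qed
  then have "descents n (word_perm g) = {1..<n}" by (auto simp: descents_def)
  then have "word_perm g = word_perm d"
    using eq_longest_perm word_perm_permutes reduced_lists g(1) assms(1,2) by metis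
  then show ?thesis using braid_ldvd_cong[OF g(2) matsumoto[OF g(1) assms(1)]] by blast
qed

section \<open>Simple elements and permutations\<close>

lemma carrier_braid_monoid: "carrier (braid_monoid n) = braid n ` lists {1..<n}"
  by (auto simp: braid_monoid_def presented_monoid_def quotient_def braid_def)

lemma mult_braid:
  assumes "u \<in> lists {1..<n}" "v \<in> lists {1..<n}"
  shows "braid n u \<otimes>\<^bsub>braid_monoid n\<^esub> braid n v = braid n (u @ v)"
proof -
  have "braid n (u' @ v') = braid n (u @ v)" if "u' \<in> braid n u" "v' \<in> braid n v" for u' v'
  proof -
    have "braid_eq n (u @ v) (u' @ v')"
      using monoid_cong_append that by (simp add: braid_def)
    then show ?thesis using braid_eq_iff[of "u @ v" n "u' @ v'"] assms by simp
  qed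
  moreover have "u \<in> braid n u" "v \<in> braid n v"
    using assms by (auto simp: braid_def intro: monoid_cong.refl)
  moreover have "braid n u \<otimes>\<^bsub>braid_monoid n\<^esub> braid n v =
      (\<Union>u'\<in>braid n u. \<Union>v'\<in>braid n v. braid n (u' @ v'))"
    by (simp add: braid_monoid_def presented_monoid_def braid_def)
  ultimately show ?thesis by blast
qed

lemma divides_braid:
  assumes "u \<in> lists {1..<n}" "v \<in> lists {1..<n}"
  shows "braid n u divides\<^bsub>braid_monoid n\<^esub> braid n v \<longleftrightarrow> braid_ldvd n u v"
proof -
  have "(\<exists>z\<in>lists {1..<n}. braid n v = braid n (u @ z)) \<longleftrightarrow> braid_ldvd n u v"
  proof
    assume "\<exists>z\<in>lists {1..<n}. braid n v = braid n (u @ z)"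
    then show "braid_ldvd n u v"
      using braid_eq_iff[OF assms(2)] monoid_cong.sym unfolding braid_ldvd_def by blast
  next
    assume "braid_ldvd n u v"
    then obtain z where z: "braid_eq n (u @ z) v" by (auto simp: braid_ldvd_def)
    then show "\<exists>z\<in>lists {1..<n}. braid n v = braid n (u @ z)"
      using monoid_cong_lists(1)[OF z] braid_eq_iff[of "u @ z" n v] by auto
  qed
  then show ?thesis using assms by (simp add: factor_def carrier_braid_monoid mult_braid)
qed

lemma has_suffix_braid:
  assumes "u \<in> lists {1..<n}" "v \<in> lists {1..<n}"
  shows "has_suffix (braid_monoid n) (braid n v) (braid n u) \<longleftrightarrow> (\<exists>z. braid_eq n (z @ u) v)"
proof -
  have "(\<exists>z\<in>lists {1..<n}. braid n v = braid n (z @ u)) \<longleftrightarrow> (\<exists>z. braid_eq n (z @ u) v)"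
  proof
    assume "\<exists>z\<in>lists {1..<n}. braid n v = braid n (z @ u)"
    then show "\<exists>z. braid_eq n (z @ u) v"
      using braid_eq_iff[OF assms(2)] monoid_cong.sym by blast
  next
    assume "\<exists>z. braid_eq n (z @ u) v"
    then obtain z where z: "braid_eq n (z @ u) v" by blast
    then show "\<exists>z\<in>lists {1..<n}. braid n v = braid n (z @ u)"
      using monoid_cong_lists(1)[OF z] braid_eq_iff[of "z @ u" n v] by auto
  qed
  then show ?thesis using assms by (simp add: has_suffix_def carrier_braid_monoid mult_braid)
qed

lemma sigma_braid: "sigma n i = braid n [i]"
  by (simp add: sigma_def braid_def)

lemma strand_perm_braid:
  assumes "w \<in> lists {1..<n}"
  shows "strand_perm (braid n w) = word_perm w"
proof -
  have "w \<in> braid n w" using assms by (auto simp: braid_def intro: monoid_cong.refl)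
  moreover have "word_perm v = word_perm w" if "v \<in> braid n w" for v
    using that braid_eq_invariant(2) by (fastforce simp: braid_def)
  ultimately have "word_perm ` braid n w = {word_perm w}" by blast
  then show ?thesis by (simp add: strand_perm_def)
qed

lemma strand_perm_sigma: "i \<in> {1..<n} \<Longrightarrow> strand_perm (sigma n i) = transpose i (Suc i)"
  using strand_perm_braid[of "[i]" n] by (simp add: sigma_braid)

lemma inj_on_sigma: "inj_on (sigma n) {1..<n}"
proof (rule inj_onI)
  fix i j assume ij: "i \<in> {1..<n}" "j \<in> {1..<n}" "sigma n i = sigma n j"
  then have "transpose i (Suc i) = transpose j (Suc j)" using strand_perm_sigma by metis
  then have "transpose i (Suc i) i = transpose j (Suc j) i" by simp
  then show "i = j" by (auto simp: transpose_def split: if_splits)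
qed

lemma ex_longest_word: "\<exists>d. reduced n d \<and> word_perm d = longest_perm n"
  using ex_reduced longest_perm_permutes by blast

text \<open>The definite description is justified by length: two least common multiples divide each
  other, so the cofactor is the empty word.\<close>

lemma garside_braid:
  assumes d: "reduced n d" "word_perm d = longest_perm n"
  shows "garside n = braid n d"
  unfolding garside_def
proof (rule the_equality)
  have dl: "d \<in> lists {1..<n}" using reduced_lists[OF d(1)] .
  have dd: "descents n (word_perm d) = {1..<n}" using d(2) descents_longest_perm by simp
  have atom: "(\<forall>a\<in>atoms n. a divides\<^bsub>braid_monoid n\<^esub> braid n y) \<longleftrightarrow>
      (\<forall>i\<in>{1..<n}. braid_ldvd n [i] y)" if "y \<in> lists {1..<n}" for y
    using divides_braid[OF _ that] by (auto simp: atoms_def sigma_braid)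
  have "\<forall>i\<in>{1..<n}. braid_ldvd n [i] d"
    using ex_Cons_if_descent[OF d(1)] dd by (auto simp: braid_ldvd_def)
  moreover have "braid_ldvd n d y" if "y \<in> lists {1..<n}" "\<forall>i\<in>{1..<n}. braid_ldvd n [i] y" for y
    using longest_ldvd[OF d(1) dd that(1)] that(2) by blast
  ultimately show lcm: "is_prefix_lcm (braid_monoid n) (atoms n) (braid n d)"
    unfolding is_prefix_lcm_def using dl atom divides_braid[OF dl]
    by (auto simp: carrier_braid_monoid)
  fix x assume x: "is_prefix_lcm (braid_monoid n) (atoms n) x"
  then obtain u where u: "u \<in> lists {1..<n}" "x = braid n u"
    by (auto simp: is_prefix_lcm_def carrier_braid_monoid)
  have "braid_ldvd n u d" "braid_ldvd n d u"
    using lcm x divides_braid[OF u(1) dl] divides_braid[OF dl u(1)]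
    unfolding u(2) is_prefix_lcm_def by blast+
  then obtain z where "braid_eq n (u @ z) d" "length d \<le> length u"
    using braid_ldvd_length by (auto simp: braid_ldvd_def)
  moreover from this have "z = []" using braid_eq_invariant(1)[of "u @ z" d n] by (cases z) auto
  ultimately show "x = braid n d" using u braid_eq_iff[OF u(1)] by simp
qed

text \<open>A reduced word is extended on the right while it stays reduced, which must end because
  the number of inversions is bounded. A maximal extension can take no further letter, so the
  inverse of its permutation has every descent.\<close>

lemma reduced_ldvd_longest:
  assumes "reduced n u" "reduced n d" "word_perm d = longest_perm n"
  shows "braid_ldvd n u d"
proof -
  define P where "P z \<longleftrightarrow> reduced n (u @ z)" for z
  have "length w < Suc (card ({1..n} \<times> {1..n}))" if "reduced n w" for w
  proof -
    have "inversions n (word_perm w) \<subseteq> {1..n} \<times> {1..n}" by (auto simp: inversions_def)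
    then have "card (inversions n (word_perm w)) \<le> card ({1..n} \<times> {1..n})"
      by (intro card_mono) auto
    then show ?thesis using reduced_length[OF that] by (simp add: inv_count_def)
  qed
  then have "\<forall>z. P z \<longrightarrow> length z < Suc (card ({1..n} \<times> {1..n}))"
    unfolding P_def by fastforce
  moreover have "P []" using assms(1) by (simp add: P_def)
  ultimately obtain z where z: "P z" "\<And>z'. P z' \<Longrightarrow> length z' \<le> length z"
    using ex_has_greatest_nat[of P "[]" length "Suc (card ({1..n} \<times> {1..n}))"] by blast
  let ?p = "word_perm (u @ z)"
  have p: "?p permutes {1..n}" using z(1) reduced_lists word_perm_permutes unfolding P_def by blast
  have "i \<in> descents n (inv' ?p)" if i: "i \<in> {1..<n}" for i
  proof (rule ccontr)
    assume "i \<notin> descents n (inv' ?p)"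
    then have "inv' ?p i < inv' ?p (Suc i)"
      using permutes_adjacent_cases[OF permutes_inv[OF p], of i] i by (auto simp: descents_def)
    then have "P (z @ [i])" using z(1) reduced_snoc[OF i, of "u @ z"] by (simp add: P_def)
    then show False using z(2) by fastforce
  qed
  then have "descents n (inv' ?p) = {1..<n}" by (auto simp: descents_def)
  then have "inv' ?p = longest_perm n" by (rule eq_longest_perm[OF permutes_inv[OF p]])
  then have "?p = longest_perm n"
    using permutes_inv_inv[OF p] longest_inv' by metis
  then have "braid_eq n (u @ z) d"
    using matsumoto[of n "u @ z" d] z(1) assms by (simp add: P_def)
  then show ?thesis by (auto simp: braid_ldvd_def)
qed

text \<open>Prefixes of reduced words are reduced, and every reduced word extends to a word of the
  longest permutation.\<close>

lemma simple_elements_braid: "simple_elements n = braid n ` {w. reduced n w}"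
proof -
  obtain d where d: "reduced n d" "word_perm d = longest_perm n" using ex_longest_word by blast
  have dl: "d \<in> lists {1..<n}" using reduced_lists[OF d(1)] .
  have "braid_ldvd n w d \<longleftrightarrow> reduced n w" if "w \<in> lists {1..<n}" for w
    using reduced_ldvd_longest[OF _ d] braid_eq_reduced d(1) reduced_appendD1
    unfolding braid_ldvd_def by metis
  then show ?thesis
    using divides_braid[OF _ dl] reduced_lists
    by (auto simp: simple_elements_def garside_braid[OF d] carrier_braid_monoid)
qed

lemma bij_betw_strand_perm:
  "bij_betw strand_perm (simple_elements n) {p. p permutes {1..n}}"
  unfolding bij_betw_def
proof
  show "inj_on strand_perm (simple_elements n)"
  proof (rule inj_onI)
    fix x y assume xy: "x \<in> simple_elements n" "y \<in> simple_elements n" "strand_perm x = strand_perm y"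
    obtain u v where uv: "reduced n u" "x = braid n u" "reduced n v" "y = braid n v"
      using xy by (auto simp: simple_elements_braid)
    then have "word_perm u = word_perm v" using xy(3) strand_perm_braid reduced_lists by metis
    then show "x = y" using uv matsumoto braid_eq_iff reduced_lists by metis
  qed
  show "strand_perm ` simple_elements n = {p. p permutes {1..n}}"
  proof (intro subset_antisym subsetI)
    fix p assume "p \<in> strand_perm ` simple_elements n"
    then show "p \<in> {p. p permutes {1..n}}"
      using strand_perm_braid reduced_lists word_perm_permutes by (auto simp: simple_elements_braid)
  next
    fix p assume "p \<in> {p. p permutes {1..n}}"
    then obtain w where w: "reduced n w" "word_perm w = p" using ex_reduced by blast
    then have "p = strand_perm (braid n w)" using strand_perm_braid reduced_lists by metis
    then show "p \<in> strand_perm ` simple_elements n" using w(1) by (auto simp: simple_elements_braid)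
  qed
qed

lemma starting_set_simple:
  assumes "s \<in> simple_elements n"
  shows "starting_set n s = sigma n ` descents n (strand_perm s)"
proof -
  obtain w where w: "reduced n w" "s = braid n w" using assms by (auto simp: simple_elements_braid)
  have wl: "w \<in> lists {1..<n}" using reduced_lists[OF w(1)] .
  have "braid_ldvd n [i] w \<longleftrightarrow> i \<in> descents n (word_perm w)" for i
    using ex_Cons_if_descent[OF w(1)] descents_if_braid_eq_Cons[OF w(1)]
    by (auto simp: braid_ldvd_def)
  then have "sigma n i divides\<^bsub>braid_monoid n\<^esub> s \<longleftrightarrow> i \<in> descents n (strand_perm s)"
    if "i \<in> {1..<n}" for i
    using divides_braid[OF _ wl, of "[i]"] strand_perm_braid[OF wl] that
    by (simp add: w(2) sigma_braid)
  moreover have "descents n (strand_perm s) \<subseteq> {1..<n}" by (auto simp: descents_def)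
  ultimately show ?thesis by (auto simp: starting_set_def atoms_def)
qed

text \<open>Suffixes are read off as prefixes of the reversed word. The factorisation found there is
  carried back by Matsumoto's theorem, which takes the place of a proof that the congruence is
  closed under reversal.\<close>

lemma finishing_set_simple:
  assumes "s \<in> simple_elements n"
  shows "finishing_set n s = sigma n ` descents n (inv' (strand_perm s))"
proof -
  obtain w where w: "reduced n w" "s = braid n w" using assms by (auto simp: simple_elements_braid)
  have wl: "w \<in> lists {1..<n}" using reduced_lists[OF w(1)] .
  have "(\<exists>z. braid_eq n (z @ [i]) w) \<longleftrightarrow> i \<in> descents n (inv' (word_perm w))" for i
  proof
    assume "\<exists>z. braid_eq n (z @ [i]) w"
    then obtain z where z: "braid_eq n (z @ [i]) w" by blast
    then have "reduced n (z @ [i])" "word_perm (z @ [i]) = word_perm w"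
      using braid_eq_reduced w(1) braid_eq_invariant(2) by blast+
    then have "reduced n (i # rev z)" "inv' (word_perm w) = word_perm (i # rev z)"
      using reduced_rev[of n "z @ [i]"] word_perm_rev[of "z @ [i]"] by auto
    then show "i \<in> descents n (inv' (word_perm w))" using descents_word_perm_Cons by metis
  next
    assume i: "i \<in> descents n (inv' (word_perm w))"
    have p: "word_perm w permutes {1..n}" using word_perm_permutes[OF wl] .
    obtain z where z: "braid_eq n (i # z) (rev w)"
      using ex_Cons_if_descent[of n "rev w" i] w(1) i by (auto simp: word_perm_rev)
    then have iz: "reduced n (i # z)" "word_perm (i # z) = word_perm (rev w)"
      using braid_eq_reduced w(1) braid_eq_invariant(2) by (metis reduced_rev)+
    have "word_perm (rev z @ [i]) = inv' (word_perm (rev w))"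
      using iz(2) word_perm_rev[of "i # z"] by (metis rev.simps(2))
    also have "\<dots> = word_perm w"
      using word_perm_rev[of "rev w"] by simp
    finally have "braid_eq n (rev z @ [i]) w"
      using matsumoto[of n "rev z @ [i]" w] w(1) iz(1) reduced_rev[of n "i # z"] by simp
    then show "\<exists>z. braid_eq n (z @ [i]) w" by blast
  qed
  then have "has_suffix (braid_monoid n) s (sigma n i) \<longleftrightarrow>
      i \<in> descents n (inv' (strand_perm s))" if "i \<in> {1..<n}" for i
    using has_suffix_braid[OF _ wl, of "[i]"] strand_perm_braid[OF wl] that
    by (simp add: w(2) sigma_braid)
  moreover have "descents n (inv' (strand_perm s)) \<subseteq> {1..<n}" by (auto simp: descents_def)
  ultimately show ?thesis by (auto simp: finishing_set_def atoms_def)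
qed

section \<open>Counting permutations with prescribed descents\<close>

definition descent_restricted :: "nat \<Rightarrow> nat set \<Rightarrow> nat set \<Rightarrow> (nat \<Rightarrow> nat) set" where
  "descent_restricted n I K =
    {p. p permutes {1..n} \<and> descents n p \<subseteq> I \<and> descents n (inv' p) \<subseteq> K}"

text \<open>\<open>b\<close> names the blocks into which the cuts in \<open>I\<close> divide
  \<open>{1..n}\<close>. The names increase from left to right, so that order arguments apply; which
  naturals serve as names is left open.\<close>

definition labelling :: "nat \<Rightarrow> nat set \<Rightarrow> (nat \<Rightarrow> nat) \<Rightarrow> bool" where
  "labelling n I b \<longleftrightarrow> (\<forall>x\<in>{1..<n}. b x \<le> b (Suc x) \<and> (b x = b (Suc x) \<longleftrightarrow> x \<notin> I))"

text \<open>Entries are indexed by all pairs of naturals and vanish for names not in use, so a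
  bijection of the naturals acts on the rows.\<close>

definition label_table ::
    "nat \<Rightarrow> (nat \<Rightarrow> nat) \<Rightarrow> (nat \<Rightarrow> nat) \<Rightarrow> (nat \<Rightarrow> nat) \<Rightarrow> nat \<times> nat \<Rightarrow> nat" where
  "label_table n b d p = (\<lambda>(m, l). card {x \<in> {1..n}. b x = m \<and> d (p x) = l})"

lemma labelling_mono:
  assumes "labelling n I b" "u \<le> v" "u \<in> {1..n}" "v \<in> {1..n}"
  shows "b u \<le> b v"
proof (cases "u = v")
  case False
  then show ?thesis using chain_interval[of "(\<le>)" u v b] assms by (simp add: labelling_def)
qed simp

lemma labelling_notin:
  assumes "labelling n I b" "u \<in> {1..n}" "v \<in> {1..n}" "b u = b v" "u \<le> i" "i < v"
  shows "i \<notin> I"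
proof -
  have "b u \<le> b i" "b (Suc i) \<le> b v" "b i \<le> b (Suc i)"
    using assms labelling_mono[OF assms(1), of u i] labelling_mono[OF assms(1), of "Suc i" v]
      labelling_mono[OF assms(1), of i "Suc i"] by auto
  then show ?thesis using assms by (auto simp: labelling_def)
qed

lemma labelling_transpose:
  assumes "labelling n I b" "i \<in> {1..<n}" "i \<notin> I"
  shows "b (transpose i (Suc i) x) = b x"
proof -
  have "b i = b (Suc i)" using assms by (auto simp: labelling_def)
  then show ?thesis by (simp add: transpose_def)
qed

lemma labelling_increasing:
  assumes "labelling n I b" "descents n p \<subseteq> I" "p permutes {1..n}"
    and "u \<in> {1..n}" "v \<in> {1..n}" "b u = b v" "u < v"
  shows "p u < p v"
proof (rule chain_interval[of "(<)" u v p])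
  fix i assume i: "u \<le> i" "i < v"
  then have "i \<notin> descents n p" using labelling_notin[OF assms(1,4,5,6)] assms(2) by blast
  then show "p i < p (Suc i)"
    using permutes_adjacent_cases[OF assms(3), of i] i assms(4,5) by (auto simp: descents_def)
qed (use assms in auto)

lemma label_table_comp_right:
  assumes "r permutes {1..n}"
  shows "label_table n b d (q \<circ> r) = label_table n (b \<circ> inv' r) d q"
proof
  fix z :: "nat \<times> nat"
  obtain m l where z: "z = (m, l)" by (cases z)
  have "bij_betw r {x \<in> {1..n}. b x = m \<and> d (q (r x)) = l}
      {y \<in> {1..n}. b (inv' r y) = m \<and> d (q y) = l}"
    using permutes_in_image[OF assms] permutes_in_image[OF permutes_inv[OF assms]]
      permutes_inverses[OF assms]
    by (intro bij_betwI[of _ _ _ "inv' r"]) auto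
  then show "label_table n b d (q \<circ> r) z = label_table n (b \<circ> inv' r) d q z"
    by (simp add: z label_table_def bij_betw_same_card)
qed

text \<open>Take the fewest inversions among the permutations with the given table. A descent
  outside \<open>I\<close> or an inverse descent outside \<open>K\<close> joins two points of one
  block, and exchanging those positions or values lowers the number of inversions without changing
  the table.\<close>

lemma label_table_minimal_representative:
  assumes "labelling n I b" "labelling n K d" "p permutes {1..n}"
  obtains q where "q \<in> descent_restricted n I K" "label_table n b d q = label_table n b d p"
proof -
  define P where "P q \<longleftrightarrow> q permutes {1..n} \<and> label_table n b d q = label_table n b d p" for q
  have "P p" using assms by (simp add: P_def)
  then obtain q where q: "P q" "\<And>q'. P q' \<Longrightarrow> inv_count n q \<le> inv_count n q'"
    using ex_has_least_nat[of P p "inv_count n"] by blast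
  have qp: "q permutes {1..n}" using q(1) by (simp add: P_def)
  have "i \<in> I" if i: "i \<in> descents n q" for i
  proof (rule ccontr)
    assume "i \<notin> I"
    have i': "i \<in> {1..<n}" "q (Suc i) < q i" using i by (auto simp: descents_def)
    let ?t = "transpose i (Suc i)"
    have "label_table n b d (q \<circ> ?t) = label_table n b d q"
      using labelling_transpose[OF assms(1) i'(1) \<open>i \<notin> I\<close>]
        label_table_comp_right[OF adjacent_transpose_permutes[OF i'(1)]]
      by (simp add: inv_unique_comp comp_def)
    then have "P (q \<circ> ?t)"
      using q(1) permutes_compose[OF adjacent_transpose_permutes[OF i'(1)] qp] by (simp add: P_def)
    then show False using q(2) inv_count_comp_transpose_descent[of i n q, OF i'] by fastforce
  qed
  moreover have "i \<in> K" if i: "i \<in> descents n (inv' q)" for i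
  proof (rule ccontr)
    assume "i \<notin> K"
    have i': "i \<in> {1..<n}" "inv' q (Suc i) < inv' q i" using i by (auto simp: descents_def)
    let ?t = "transpose i (Suc i)"
    have t: "?t permutes {1..n}" using adjacent_transpose_permutes[OF i'(1)] .
    have "label_table n b d (?t \<circ> q) = label_table n b d q"
      using labelling_transpose[OF assms(2) i'(1) \<open>i \<notin> K\<close>] by (simp add: label_table_def)
    moreover have tq: "(?t \<circ> q) permutes {1..n}" using permutes_compose[OF qp t] .
    ultimately have "inv_count n q \<le> inv_count n (?t \<circ> q)" using q by (simp add: P_def)
    moreover have "inv' (?t \<circ> q) = inv' q \<circ> ?t"
      using permutes_bij[OF qp] permutes_bij[OF t] by (simp add: o_inv_distrib)
    ultimately show False
      using inv_count_comp_transpose_descent[of i n "inv' q", OF i'] inv_count_inv[OF qp]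
        inv_count_inv[OF tq] by simp
  qed
  ultimately show ?thesis using that[of q] q(1) by (auto simp: P_def descent_restricted_def)
qed

lemma count_image_mset_mset_set:
  assumes "finite A"
  shows "count (image_mset f (mset_set A)) m = card {a \<in> A. f a = m}"
  using assms
proof (induction A rule: finite_induct)
  case (insert x A)
  have "{a \<in> insert x A. f a = m} =
      (if f x = m then insert x {a \<in> A. f a = m} else {a \<in> A. f a = m})" by auto
  then show ?case using insert by simp
qed simp

text \<open>Along the increasing enumeration of \<open>V\<close>, both functions give the sorted
  list of the same multiset.\<close>

lemma mono_on_eq_if_same_counts:
  fixes f g :: "nat \<Rightarrow> nat"
  assumes "finite V" "mono_on V f" "mono_on V g"
    and "\<And>m. card {v \<in> V. f v = m} = card {v \<in> V. g v = m}"
    and "v \<in> V"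
  shows "f v = g v"
proof -
  let ?L = "sorted_list_of_set V"
  have sorted: "sorted (map h ?L)" if "mono_on V h" for h :: "nat \<Rightarrow> nat"
    unfolding sorted_map
    by (rule sorted_wrt_mono_rel[OF _ sorted_sorted_list_of_set]) (use assms(1) mono_onD[OF that] in auto)
  have "mset (map f ?L) = mset (map g ?L)"
    using assms(1,4)
    by (intro multiset_eqI)
      (simp add: count_image_mset_mset_set flip: sorted_list_of_mset_set)
  then have "map f ?L = map g ?L"
    using sorted[OF assms(2)] sorted[OF assms(3)] by (metis properties_for_sort)
  then show ?thesis using assms(1,5) by auto
qed

text \<open>The inverse of \<open>p\<close> is increasing on every block of \<open>K\<close>, so the
  names of the blocks of \<open>I\<close> that it meets there form a monotone sequence whose
  multiplicities stand in the table. Once the block of every preimage is known, preimages within one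
  block of \<open>I\<close> are ordered like their values, and this order determines the
  inverse.\<close>

lemma label_table_inj:
  assumes "labelling n I b" "labelling n K d"
  shows "inj_on (label_table n b d) (descent_restricted n I K)"
proof (rule inj_onI)
  fix p q
  assume p: "p \<in> descent_restricted n I K" and q: "q \<in> descent_restricted n I K"
    and eq: "label_table n b d p = label_table n b d q"
  have count: "card {v \<in> {v \<in> {1..n}. d v = l}. b (inv' r v) = m} = label_table n b d r (m, l)"
    if r: "r permutes {1..n}" for r m l
  proof -
    have "bij_betw r {x \<in> {1..n}. b x = m \<and> d (r x) = l}
        {v \<in> {v \<in> {1..n}. d v = l}. b (inv' r v) = m}"
      using permutes_in_image[OF r] permutes_in_image[OF permutes_inv[OF r]] permutes_inverses[OF r]
      by (intro bij_betwI[of _ _ _ "inv' r"]) auto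
    then show ?thesis by (simp add: label_table_def bij_betw_same_card)
  qed
  have mono: "mono_on {v \<in> {1..n}. d v = l} (\<lambda>v. b (inv' r v))"
    if r: "r \<in> descent_restricted n I K" for r l
  proof (rule mono_onI)
    fix u v assume uv: "u \<in> {v \<in> {1..n}. d v = l}" "v \<in> {v \<in> {1..n}. d v = l}" "u \<le> v"
    have rp: "inv' r permutes {1..n}" "descents n (inv' r) \<subseteq> K"
      using r by (auto simp: descent_restricted_def permutes_inv)
    have "inv' r u \<le> inv' r v"
      using labelling_increasing[OF assms(2) rp(2,1), of u v] uv by (cases "u = v") auto
    then show "b (inv' r u) \<le> b (inv' r v)"
      using labelling_mono[OF assms(1)] permutes_in_image[OF rp(1)] uv by blast
  qed
  have pp: "p permutes {1..n}" "descents n p \<subseteq> I" and qp: "q permutes {1..n}" "descents n q \<subseteq> I"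
    using p q by (auto simp: descent_restricted_def)
  have w: "b (inv' p v) = b (inv' q v)" if "v \<in> {1..n}" for v
    by (rule mono_on_eq_if_same_counts[OF _ mono[OF p, of "d v"] mono[OF q, of "d v"]])
      (use that in \<open>simp_all only: count[OF pp(1)] count[OF qp(1)] eq, simp_all\<close>)
  have rank: "inv' r u < inv' r v \<longleftrightarrow>
      b (inv' r u) < b (inv' r v) \<or> b (inv' r u) = b (inv' r v) \<and> u < v"
    if r: "r permutes {1..n}" "descents n r \<subseteq> I" and uv: "u \<in> {1..n}" "v \<in> {1..n}" for r u v
  proof -
    have "inv' r u \<in> {1..n}" "inv' r v \<in> {1..n}"
      using permutes_in_image[OF permutes_inv[OF r(1)]] uv by blast+
    then show ?thesis
      using labelling_increasing[OF assms(1) r(2,1), of "inv' r u" "inv' r v"]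
        labelling_increasing[OF assms(1) r(2,1), of "inv' r v" "inv' r u"]
        labelling_mono[OF assms(1), of "inv' r u" "inv' r v"]
        labelling_mono[OF assms(1), of "inv' r v" "inv' r u"]
        permutes_inverses[OF r(1)]
      by (metis less_irrefl linorder_neqE_nat nat_less_le not_less_iff_gr_or_eq)
  qed
  have "inv' p = inv' q"
  proof (rule permutes_eqI)
    show "inv' p u \<le> inv' p v \<longleftrightarrow> inv' q u \<le> inv' q v"
      if "u \<in> {1..n}" "v \<in> {1..n}" for u v
      using rank[OF pp that(2,1)] rank[OF qp that(2,1)] w[OF that(1)] w[OF that(2)]
      by (simp add: not_less[symmetric])
  qed (use pp qp permutes_inv in auto)
  then show "p = q" using permutes_inv_inv[OF pp(1)] permutes_inv_inv[OF qp(1)] by metis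
qed

lemma card_descent_restricted:
  assumes "labelling n I b" "labelling n K d"
  shows "card (descent_restricted n I K) = card (label_table n b d ` {p. p permutes {1..n}})"
proof -
  have "label_table n b d ` descent_restricted n I K = label_table n b d ` {p. p permutes {1..n}}"
  proof (intro subset_antisym subsetI)
    fix T assume "T \<in> label_table n b d ` {p. p permutes {1..n}}"
    then obtain p where "p permutes {1..n}" "T = label_table n b d p" by blast
    then show "T \<in> label_table n b d ` descent_restricted n I K"
      using label_table_minimal_representative[OF assms, of p] by (metis image_eqI)
  qed (auto simp: descent_restricted_def)
  then show ?thesis using card_image[OF label_table_inj[OF assms]] by simp
qed

text \<open>Permuting the labels of \<open>b\<close> permutes the rows of the tables.\<close>

lemma card_label_tables_cong:
  assumes "bij \<tau>" "\<And>m. card {x \<in> {1..n}. b1 x = m} = card {x \<in> {1..n}. b2 x = \<tau> m}"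
  shows "card (label_table n b1 d ` {p. p permutes {1..n}}) =
    card (label_table n b2 d ` {p. p permutes {1..n}})"
proof -
  have "image_mset (\<tau> \<circ> b1) (mset_set {1..n}) = image_mset b2 (mset_set {1..n})"
  proof (rule multiset_eqI)
    fix m
    have "{x \<in> {1..n}. (\<tau> \<circ> b1) x = m} = {x \<in> {1..n}. b1 x = inv' \<tau> m}"
      using bij_inv_eq_iff[OF assms(1)] by auto
    then show "count (image_mset (\<tau> \<circ> b1) (mset_set {1..n})) m =
        count (image_mset b2 (mset_set {1..n})) m"
      using assms by (simp add: count_image_mset_mset_set bij_is_surj surj_f_inv_f)
  qed
  \<comment> \<open>The functions \<open>\<tau> \<circ> b1\<close> and \<open>b2\<close> take each
    value equally often, so they differ by a rearrangement \<open>r\<close> of the points.\<close>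
  then obtain r where r: "r permutes {1..n}" "\<forall>x\<in>{1..n}. (\<tau> \<circ> b1) x = b2 (r x)"
    by (rule image_mset_eq_implies_permutes[OF finite_atLeastAtMost])
  have tab: "label_table n b1 d (p \<circ> r) (m, l) = label_table n b2 d p (\<tau> m, l)" for p m l
  proof -
    have ri: "inv' r x \<in> {1..n}" if "x \<in> {1..n}" for x
      using permutes_in_image[OF permutes_inv[OF r(1)]] that by blast
    have "b1 (inv' r x) = m \<longleftrightarrow> b2 x = \<tau> m" if "x \<in> {1..n}" for x
      using bspec[OF r(2) ri[OF that]] permutes_inverses[OF r(1)] bij_is_inj[OF assms(1)]
      by (metis comp_apply inj_eq)
    then have "{x \<in> {1..n}. b1 (inv' r x) = m \<and> d (p x) = l} =
        {x \<in> {1..n}. b2 x = \<tau> m \<and> d (p x) = l}" by blast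
    then show ?thesis unfolding label_table_comp_right[OF r(1)] by (simp add: label_table_def)
  qed
  define \<Phi> where "\<Phi> T = (\<lambda>(m, l). T (\<tau> m, l))" for T :: "nat \<times> nat \<Rightarrow> nat"
  have inj: "inj \<Phi>"
  proof (rule injI)
    fix T U assume eq: "\<Phi> T = \<Phi> U"
    show "T = U"
    proof
      fix z :: "nat \<times> nat"
      obtain m l where z: "z = (\<tau> m, l)" using bij_is_surj[OF assms(1)] by (metis surj_def prod.exhaust)
      show "T z = U z" using fun_cong[OF eq, of "(m, l)"] by (simp add: \<Phi>_def z)
    qed
  qed
  have \<Phi>: "\<Phi> (label_table n b2 d p) = label_table n b1 d (p \<circ> r)" for p
    using tab by (auto simp: \<Phi>_def)
  \<comment> \<open>Composition with \<open>r\<close> on the right is a bijection of the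
    permutations, so renaming the rows maps one set of tables onto the other.\<close>
  have "label_table n b1 d ` {p. p permutes {1..n}} =
      \<Phi> ` label_table n b2 d ` {p. p permutes {1..n}}"
  proof (intro subset_antisym subsetI)
    fix T assume "T \<in> label_table n b1 d ` {p. p permutes {1..n}}"
    then obtain p where p: "p permutes {1..n}" "T = label_table n b1 d p" by blast
    have "p = (p \<circ> inv' r) \<circ> r" using permutes_inv_o[OF r(1)] by (simp add: comp_assoc)
    then have "T = \<Phi> (label_table n b2 d (p \<circ> inv' r))" using \<Phi> p(2) by metis
    then show "T \<in> \<Phi> ` label_table n b2 d ` {p. p permutes {1..n}}"
      using permutes_compose[OF permutes_inv[OF r(1)] p(1)] by blast
  next
    fix T assume "T \<in> \<Phi> ` label_table n b2 d ` {p. p permutes {1..n}}"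
    then show "T \<in> label_table n b1 d ` {p. p permutes {1..n}}"
      using \<Phi> permutes_compose[OF r(1)] by auto
  qed
  then show ?thesis using card_image[OF inj_on_subset[OF inj subset_UNIV]] by simp
qed

text \<open>Inclusion-exclusion in the form of strong induction: the fibres over the proper subsets
  of \<open>Z\<close> already agree in size and are subtracted.\<close>

lemma card_eq_if_card_subset_eq:
  fixes f g :: "'a \<Rightarrow> 'b set"
  assumes "finite A" "finite B"
    and sub: "\<And>K. K \<subseteq> U \<Longrightarrow> card {a \<in> A. f a \<subseteq> K} = card {b \<in> B. g b \<subseteq> K}"
    and "finite Z" "Z \<subseteq> U"
  shows "card {a \<in> A. f a = Z} = card {b \<in> B. g b = Z}"
  using assms(4,5)
proof (induction Z rule: finite_psubset_induct)
  case (psubset Z)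
  have split: "card {c \<in> C. h c \<subseteq> Z} = card {c \<in> C. h c = Z} + (\<Sum>Y\<in>{Y. Y \<subset> Z}. card {c \<in> C. h c = Y})"
    if "finite C" for C :: "'a set" and h :: "'a \<Rightarrow> 'b set"
  proof -
    have "{c \<in> C. h c \<subseteq> Z} = {c \<in> C. h c = Z} \<union> (\<Union>Y\<in>{Y. Y \<subset> Z}. {c \<in> C. h c = Y})" by auto
    moreover have "{c \<in> C. h c = Z} \<inter> (\<Union>Y\<in>{Y. Y \<subset> Z}. {c \<in> C. h c = Y}) = {}" by auto
    moreover have "finite {Y. Y \<subset> Z}"
      by (rule finite_subset[of _ "Pow Z"]) (use psubset in auto)
    ultimately show ?thesis using that
      by (simp add: card_Un_disjoint card_UN_disjoint disjoint_iff)
  qed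
  have "(\<Sum>Y\<in>{Y. Y \<subset> Z}. card {a \<in> A. f a = Y}) = (\<Sum>Y\<in>{Y. Y \<subset> Z}. card {b \<in> B. g b = Y})"
    using psubset by (intro sum.cong) auto
  then show ?case using split[OF assms(1), of f] split[OF assms(2), of g] sub[OF psubset.prems] by simp
qed

section \<open>Blocks and degrees\<close>

text \<open>The cut \<open>i\<close> lies between \<open>i\<close> and \<open>Suc i\<close>, and a
  block collects the points that no cut separates from \<open>x\<close>. In this form, permutations
  that move no point across a cut visibly preserve blocks.\<close>

definition block :: "nat \<Rightarrow> nat set \<Rightarrow> nat \<Rightarrow> nat set" where
  "block n I x = {y \<in> {1..n}. \<forall>i\<in>I. y \<le> i \<longleftrightarrow> x \<le> i}"

text \<open>The least element of a block serves both as its name in a labelling and as the index of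
  an orbit in \<open>deg\<close>.\<close>

definition block_min :: "nat \<Rightarrow> nat set \<Rightarrow> nat \<Rightarrow> nat" where
  "block_min n I x = Min (block n I x)"

lemma finite_block: "finite (block n I x)"
  by (rule finite_subset[of _ "{1..n}"]) (auto simp: block_def)

lemma self_in_block: "x \<in> {1..n} \<Longrightarrow> x \<in> block n I x"
  by (simp add: block_def)

lemma block_eq: "y \<in> block n I x \<Longrightarrow> block n I y = block n I x"
  by (auto simp: block_def)

lemma block_min_in_block: "x \<in> {1..n} \<Longrightarrow> block_min n I x \<in> block n I x"
  unfolding block_min_def using Min_in[OF finite_block] self_in_block by blast

lemma block_min_eq_iff:
  assumes "x \<in> {1..n}" "y \<in> {1..n}"
  shows "block_min n I y = block_min n I x \<longleftrightarrow> y \<in> block n I x"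
proof
  assume "block_min n I y = block_min n I x"
  then have "block n I y = block n I x"
    using block_eq[OF block_min_in_block[OF assms(1)]] block_eq[OF block_min_in_block[OF assms(2)]]
    by metis
  then show "y \<in> block n I x" using self_in_block[OF assms(2)] by blast
qed (simp add: block_min_def block_eq)

lemma labelling_block_min: "labelling n I (block_min n I)"
  unfolding labelling_def
proof
  fix x assume x: "x \<in> {1..<n}"
  then have range: "x \<in> {1..n}" "Suc x \<in> {1..n}" by auto
  show "block_min n I x \<le> block_min n I (Suc x) \<and>
      (block_min n I x = block_min n I (Suc x) \<longleftrightarrow> x \<notin> I)"
  proof (cases "x \<in> I")
    case True
    have "block_min n I x \<le> x"
      unfolding block_min_def using Min_le[OF finite_block] self_in_block[OF range(1)] by blast
    moreover have "x < block_min n I (Suc x)"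
      using block_min_in_block[OF range(2), of I] True by (force simp: block_def)
    ultimately show ?thesis using True by simp
  next
    case False
    have "x \<le> i \<longleftrightarrow> Suc x \<le> i" if "i \<in> I" for i using that False by (cases "x = i") auto
    then have "x \<in> block n I (Suc x)" using range by (auto simp: block_def)
    then have "block_min n I x = block_min n I (Suc x)"
      using block_min_eq_iff[OF range(2,1)] by blast
    then show ?thesis using False by simp
  qed
qed

section \<open>Orbits of Young subgroups\<close>

lemma carrier_perm_subgroup:
  assumes "J \<subseteq> {1..<n}"
  shows "carrier (perm_subgroup n (sigma n ` J)) =
    generate (sym_group n) ((\<lambda>j. transpose j (Suc j)) ` J)"
proof -
  have "strand_perm ` sigma n ` J = (\<lambda>j. transpose j (Suc j)) ` J"
    unfolding image_image by (rule image_cong[OF HOL.refl strand_perm_sigma]) (use assms in blast)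
  then show ?thesis by (simp add: perm_subgroup_def)
qed

text \<open>The transposition of \<open>j\<close> and \<open>Suc j\<close> crosses the cut
  \<open>j\<close> only, and this cut is absent from \<open>I\<close>. Crossing no cut in
  \<open>I\<close> is inherited by products.\<close>

lemma generate_preserves_blocks:
  assumes "I \<subseteq> {1..<n}" "g \<in> generate (sym_group n) ((\<lambda>j. transpose j (Suc j)) ` ({1..<n} - I))"
  shows "g permutes {1..n} \<and> (\<forall>x. \<forall>i\<in>I. g x \<le> i \<longleftrightarrow> x \<le> i)"
proof -
  have t: "transpose j (Suc j) permutes {1..n} \<and>
      (\<forall>x. \<forall>i\<in>I. transpose j (Suc j) x \<le> i \<longleftrightarrow> x \<le> i)" if "j \<in> {1..<n} - I" for j
  proof -
    have "transpose j (Suc j) x \<le> i \<longleftrightarrow> x \<le> i" if "i \<in> I" for x i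
      using that \<open>j \<in> {1..<n} - I\<close> by (cases "i = j") (auto simp: transpose_def)
    then show ?thesis using that adjacent_transpose_permutes by blast
  qed
  show ?thesis
    using assms(2)
  proof (induction rule: generate.induct)
    case one
    have "\<one>\<^bsub>sym_group n\<^esub> = id" by (simp add: sym_group_def)
    moreover have "id permutes {1..n} \<and> (\<forall>x. \<forall>i\<in>I. id x \<le> i \<longleftrightarrow> x \<le> i)"
      using permutes_id by auto
    ultimately show ?case by metis
  next
    case (incl h)
    then show ?case using t by blast
  next
    case (inv h)
    then obtain j where j: "j \<in> {1..<n} - I" "h = transpose j (Suc j)" by blast
    then have "h \<in> carrier (sym_group n)" using t by (simp add: sym_group_def)
    then have "inv\<^bsub>sym_group n\<^esub> h = transpose j (Suc j)"
      using j(2) by (simp add: inv_unique_comp)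
    then show ?case using t[OF j(1)] by simp
  next
    case (eng g h)
    then have "(g \<circ> h) permutes {1..n} \<and> (\<forall>x. \<forall>i\<in>I. (g \<circ> h) x \<le> i \<longleftrightarrow> x \<le> i)"
      using permutes_compose[of h "{1..n}" g] by auto
    moreover have "g \<otimes>\<^bsub>sym_group n\<^esub> h = g \<circ> h" by (simp add: sym_group_def)
    ultimately show ?case by metis
  qed
qed

text \<open>Points move one step at a time. Carrying both directions through the induction spares an
  argument about inverses in the generated subgroup.\<close>

lemma generate_transitive:
  assumes "x \<le> y" "{x..<y} \<subseteq> J"
  shows "(\<exists>g\<in>generate (sym_group n) ((\<lambda>j. transpose j (Suc j)) ` J). g x = y) \<and>
    (\<exists>g\<in>generate (sym_group n) ((\<lambda>j. transpose j (Suc j)) ` J). g y = x)"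
  using assms
proof (induction y rule: dec_induct)
  case base
  have "id \<in> generate (sym_group n) ((\<lambda>j. transpose j (Suc j)) ` J)"
    using generate.one[of "sym_group n"] by (simp add: sym_group_def)
  then show ?case by (intro conjI bexI[of _ id]) simp_all
next
  case (step y)
  let ?G = "generate (sym_group n) ((\<lambda>j. transpose j (Suc j)) ` J)"
  let ?t = "transpose y (Suc y)"
  have mult: "g \<circ> h \<in> ?G" if "g \<in> ?G" "h \<in> ?G" for g h
    using generate.eng[OF that] by (simp add: sym_group_def)
  have t: "?t \<in> ?G" using step by (intro generate.incl) auto
  have "{x..<y} \<subseteq> J" using step by auto
  then obtain g h where g: "g \<in> ?G" "g x = y" and h: "h \<in> ?G" "h y = x" using step.IH by blast
  have "\<exists>g\<in>?G. g x = Suc y" by (rule bexI[OF _ mult[OF t g(1)]]) (simp add: g(2))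
  moreover have "\<exists>g\<in>?G. g (Suc y) = x" by (rule bexI[OF _ mult[OF h(1) t]]) (simp add: h(2))
  ultimately show ?case ..
qed

lemma orbit_eq_block:
  assumes "I \<subseteq> {1..<n}" "x \<in> {1..n}"
  shows "orbit (perm_subgroup n (sigma n ` ({1..<n} - I))) (\<lambda>p. p) x = block n I x"
proof -
  let ?G = "generate (sym_group n) ((\<lambda>j. transpose j (Suc j)) ` ({1..<n} - I))"
  have "orbit (perm_subgroup n (sigma n ` ({1..<n} - I))) (\<lambda>p. p) x = {g x |g. g \<in> ?G}"
    using carrier_perm_subgroup[of "{1..<n} - I" n] by (simp add: orbit_def)
  also have "\<dots> = block n I x"
  proof (intro subset_antisym subsetI)
    fix y assume "y \<in> {g x |g. g \<in> ?G}"
    then obtain g where g: "g \<in> ?G" "y = g x" by blast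
    note p = generate_preserves_blocks[OF assms(1) g(1)]
    have "y \<in> {1..n}" using permutes_in_image[OF conjunct1[OF p]] assms(2) g(2) by blast
    then show "y \<in> block n I x" using conjunct2[OF p] g(2) by (simp add: block_def)
  next
    fix y assume y: "y \<in> block n I x"
    show "y \<in> {g x |g. g \<in> ?G}"
    proof (cases "x \<le> y")
      case True
      have "j \<in> {1..<n} - I" if "j \<in> {x..<y}" for j
        using that y assms(2) by (auto simp: block_def)
      then have "{x..<y} \<subseteq> {1..<n} - I" by blast
      then have "\<exists>g\<in>?G. g x = y" using generate_transitive[OF True] by blast
      then show ?thesis by blast
    next
      case False
      have "j \<in> {1..<n} - I" if "j \<in> {y..<x}" for j
        using that y assms(2) by (auto simp: block_def)
      then have "{y..<x} \<subseteq> {1..<n} - I" by blast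
      then have "\<exists>g\<in>?G. g x = y" using generate_transitive[of y x] False by simp
      then show ?thesis by blast
    qed
  qed
  finally show ?thesis .
qed

definition fibre_size :: "nat \<Rightarrow> (nat \<Rightarrow> nat) \<Rightarrow> nat \<Rightarrow> nat" where
  "fibre_size n b m = card {x \<in> {1..n}. b x = m}"

text \<open>\<open>deg\<close> lists the orbits by their least elements, which are the values of
  \<open>block_min\<close>; the orbit with least element \<open>m\<close> is the fibre over
  \<open>m\<close>.\<close>

lemma deg_partition_eq:
  assumes "I \<subseteq> {1..<n}"
  shows "deg_partition n (sigma n ` ({1..<n} - I)) =
    image_mset (fibre_size n (block_min n I)) (mset_set (block_min n I ` {1..n}))"
proof -
  let ?S = "perm_subgroup n (sigma n ` ({1..<n} - I))" and ?L = "block_min n I ` {1..n}"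
  have "orbits ?S {1..n} (\<lambda>p. p) = block n I ` {1..n}"
  proof -
    have "orbits ?S {1..n} (\<lambda>p. p) = orbit ?S (\<lambda>p. p) ` {1..n}" by (auto simp: orbits_def)
    also have "\<dots> = block n I ` {1..n}" by (rule image_cong[OF HOL.refl orbit_eq_block[OF assms]])
    finally show ?thesis .
  qed
  then have L: "Min ` orbits ?S {1..n} (\<lambda>p. p) = ?L"
    by (simp add: image_image block_min_def)
  have card: "card (orbit ?S (\<lambda>p. p) m) = fibre_size n (block_min n I) m" if "m \<in> ?L" for m
  proof -
    obtain x where x: "x \<in> {1..n}" "m = block_min n I x" using \<open>m \<in> ?L\<close> by blast
    have m: "m \<in> block n I x" using block_min_in_block x by blast
    then have "m \<in> {1..n}" by (simp add: block_def)
    then have "orbit ?S (\<lambda>p. p) m = block n I x"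
      using orbit_eq_block[OF assms] block_eq[OF m] by simp
    moreover have "block n I x = {y \<in> {1..n}. block_min n I y = m}"
      using block_min_eq_iff[OF x(1)] x(2) by (auto simp: block_def)
    ultimately show ?thesis by (simp add: fibre_size_def)
  qed
  have "deg_partition n (sigma n ` ({1..<n} - I)) =
      image_mset (\<lambda>m. card (orbit ?S (\<lambda>p. p) m)) (mset (sorted_list_of_set ?L))"
    by (simp only: deg_partition_def deg_def L mset_map)
  also have "\<dots> = image_mset (\<lambda>m. card (orbit ?S (\<lambda>p. p) m)) (mset_set ?L)"
    by (simp flip: sorted_list_of_mset_set)
  also have "\<dots> = image_mset (fibre_size n (block_min n I)) (mset_set ?L)"
    using card by (intro image_mset_cong) simp
  finally show ?thesis .
qed

lemma image_mset_extend_zero: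
  fixes f :: "'a \<Rightarrow> 'b :: zero"
  assumes "L \<subseteq> U" "finite U" "\<And>m. m \<in> U - L \<Longrightarrow> f m = 0"
  shows "image_mset f (mset_set U) = image_mset f (mset_set L) + replicate_mset (card U - card L) 0"
proof -
  have "mset_set U = mset_set L + mset_set (U - L)"
    using assms(1,2) mset_set_Union[of L "U - L"] finite_subset[OF assms(1,2)]
    by (simp add: Un_absorb1)
  moreover have "image_mset f (mset_set (U - L)) = image_mset (\<lambda>_. 0) (mset_set (U - L))"
    using assms(2,3) by (intro image_mset_cong) simp
  ultimately show ?thesis
    using assms by (simp add: image_mset_const_eq card_Diff_subset finite_subset)
qed

text \<open>The degrees count only names in use. Both sets of names have the same size, so padding
  with zeros up to \<open>{1..n}\<close> keeps the multisets equal. A permutation of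
  \<open>{1..n}\<close> then matches the sizes, and outside this range all sizes are zero.\<close>

lemma ex_relabelling:
  assumes "I1 \<subseteq> {1..<n}" "I2 \<subseteq> {1..<n}"
    and "deg_partition n (sigma n ` ({1..<n} - I1)) = deg_partition n (sigma n ` ({1..<n} - I2))"
  obtains \<tau> where "bij \<tau>"
    "\<And>m. fibre_size n (block_min n I1) m = fibre_size n (block_min n I2) (\<tau> m)"
proof -
  let ?f = "\<lambda>I. fibre_size n (block_min n I)" and ?L = "\<lambda>I. block_min n I ` {1..n}"
  have sub: "?L I \<subseteq> {1..n}" for I
    using block_min_in_block by (force simp: block_def)
  have zero: "?f I m = 0" if "m \<notin> ?L I" for I m
    using that by (auto simp: fibre_size_def)
  have eq: "image_mset (?f I1) (mset_set (?L I1)) = image_mset (?f I2) (mset_set (?L I2))"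
    using assms(3) unfolding deg_partition_eq[OF assms(1)] deg_partition_eq[OF assms(2)] .
  then have "card (?L I1) = card (?L I2)"
    by (metis size_image_mset size_mset_set)
  then have "image_mset (?f I1) (mset_set {1..n}) = image_mset (?f I2) (mset_set {1..n})"
    using eq image_mset_extend_zero[OF sub, of I1 "?f I1"] image_mset_extend_zero[OF sub, of I2 "?f I2"]
      zero by simp
  then obtain \<tau> where \<tau>: "\<tau> permutes {1..n}" "\<forall>m\<in>{1..n}. ?f I1 m = ?f I2 (\<tau> m)"
    by (rule image_mset_eq_implies_permutes[OF finite_atLeastAtMost])
  have "?f I1 m = ?f I2 (\<tau> m)" for m
  proof (cases "m \<in> {1..n}")
    case False
    then have "?f I m = 0" for I using zero sub by blast
    then show ?thesis using False \<tau>(1) by (simp add: permutes_not_in)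
  qed (use \<tau>(2) in blast)
  then show thesis using that permutes_bij[OF \<tau>(1)] by blast
qed

section \<open>Columns of the transition matrix\<close>

lemma card_descent_restricted_cong:
  assumes "I1 \<subseteq> {1..<n}" "I2 \<subseteq> {1..<n}"
    and "deg_partition n (sigma n ` ({1..<n} - I1)) = deg_partition n (sigma n ` ({1..<n} - I2))"
  shows "card (descent_restricted n I1 K) = card (descent_restricted n I2 K)"
proof -
  obtain \<tau> where \<tau>: "bij \<tau>"
      "\<And>m. fibre_size n (block_min n I1) m = fibre_size n (block_min n I2) (\<tau> m)"
    using ex_relabelling[OF assms] by blast
  show ?thesis
    unfolding card_descent_restricted[OF labelling_block_min labelling_block_min]
    by (rule card_label_tables_cong[OF \<tau>(1)]) (use \<tau>(2) in \<open>simp add: fibre_size_def\<close>)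
qed

text \<open>The conditional is kept because \<open>K\<close> may be empty, and then the rejected
  letters lead to this state as well.\<close>

lemma transition_matrix_eq_card_permutations:
  assumes "I \<subseteq> {1..<n}" "K \<subseteq> {1..<n}"
  shows "transition_matrix (braid_automaton n) (sigma n ` K) (sigma n ` I) =
    card {p. p permutes {1..n} \<and> (if descents n p \<subseteq> I then descents n (inv' p) else {}) = K}"
proof -
  have sub: "descents n p \<subseteq> {1..<n}" for p by (auto simp: descents_def)
  have inj: "sigma n ` A \<subseteq> sigma n ` B \<longleftrightarrow> A \<subseteq> B" if "A \<subseteq> {1..<n}" "B \<subseteq> {1..<n}" for A B
  proof
    assume "sigma n ` A \<subseteq> sigma n ` B"
    moreover have "sigma n x \<in> sigma n ` B \<longleftrightarrow> x \<in> B" if "x \<in> A" for x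
      using inj_on_image_mem_iff[OF inj_on_sigma[of n], of x B] that \<open>A \<subseteq> _\<close> \<open>B \<subseteq> _\<close> by blast
    ultimately show "A \<subseteq> B" by blast
  qed blast
  have step: "transition (braid_automaton n) (sigma n ` I) s = sigma n ` K \<longleftrightarrow>
      (if descents n (strand_perm s) \<subseteq> I then descents n (inv' (strand_perm s)) else {}) = K"
    if "s \<in> simple_elements n" for s
  proof -
    have "starting_set n s \<subseteq> sigma n ` I \<longleftrightarrow> descents n (strand_perm s) \<subseteq> I"
      unfolding starting_set_simple[OF that] by (rule inj[OF sub assms(1)])
    moreover have "finishing_set n s = sigma n ` K \<longleftrightarrow>
        descents n (inv' (strand_perm s)) = K"
      unfolding finishing_set_simple[OF that]
      by (rule inj_on_image_eq_iff[OF inj_on_sigma sub assms(2)])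
    moreover have "{} = sigma n ` K \<longleftrightarrow> {} = K" by auto
    ultimately show ?thesis
      by (cases "descents n (strand_perm s) \<subseteq> I") (simp_all add: braid_automaton_def)
  qed
  have "bij_betw strand_perm
      {s \<in> simple_elements n. transition (braid_automaton n) (sigma n ` I) s = sigma n ` K}
      {p. p permutes {1..n} \<and> (if descents n p \<subseteq> I then descents n (inv' p) else {}) = K}"
    (is "bij_betw _ ?A ?B")
  proof (rule bij_betw_subset[OF bij_betw_strand_perm])
    show "strand_perm ` ?A = ?B"
    proof (intro subset_antisym subsetI)
      fix p assume "p \<in> strand_perm ` ?A"
      then obtain s where s: "p = strand_perm s" "s \<in> ?A" by (rule imageE)
      then have "p permutes {1..n}"
        using bij_betw_imp_surj_on[OF bij_betw_strand_perm[of n]] by blast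
      then show "p \<in> ?B" using step[of s] s by simp
    next
      fix p assume p: "p \<in> ?B"
      then obtain s where "s \<in> simple_elements n" "p = strand_perm s"
        using bij_betw_imp_surj_on[OF bij_betw_strand_perm[of n]] by blast
      then show "p \<in> strand_perm ` ?A" using step[of s] p by simp
    qed
  qed auto
  then show ?thesis
    by (simp add: transition_matrix_def bij_betw_same_card braid_automaton_def)
qed

theorem corollary4p4:
  fixes n :: nat and X1 X2 :: "nat list set set"
  assumes "X1 \<subseteq> atoms n" and "X2 \<subseteq> atoms n"
    and "deg_partition n (atoms n - X1) = deg_partition n (atoms n - X2)"
  shows "\<forall>Z. Z \<subseteq> atoms n \<longrightarrow>
    transition_matrix (braid_automaton n) Z X1 = transition_matrix (braid_automaton n) Z X2"
proof (intro allI impI)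
  fix Z assume "Z \<subseteq> atoms n"
  then obtain K where K: "K \<subseteq> {1..<n}" "Z = sigma n ` K"
    using subset_imageE[of Z "sigma n" "{1..<n}"] by (auto simp: atoms_def)
  obtain I1 where I1: "I1 \<subseteq> {1..<n}" "X1 = sigma n ` I1"
    using subset_imageE[of X1 "sigma n" "{1..<n}"] assms(1) by (auto simp: atoms_def)
  obtain I2 where I2: "I2 \<subseteq> {1..<n}" "X2 = sigma n ` I2"
    using subset_imageE[of X2 "sigma n" "{1..<n}"] assms(2) by (auto simp: atoms_def)
  have "atoms n - sigma n ` I = sigma n ` ({1..<n} - I)" if "I \<subseteq> {1..<n}" for I
    using inj_on_image_set_diff[OF inj_on_sigma[of n], of "{1..<n}" I] that by (simp add: atoms_def)
  then have deg: "deg_partition n (sigma n ` ({1..<n} - I1)) =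
      deg_partition n (sigma n ` ({1..<n} - I2))"
    using assms(3) I1 I2 by simp
  define A where "A I = {p. p permutes {1..n} \<and> descents n p \<subseteq> I}" for I
  have fin_perm: "finite {p. p permutes {1..n}}" by (rule finite_permutations) simp
  then have fin: "finite (A I)" for I
    by (rule rev_finite_subset) (auto simp: A_def)
  have "{p \<in> A I. descents n (inv' p) \<subseteq> L} = descent_restricted n I L" for I L
    by (auto simp: A_def descent_restricted_def)
  then have sub: "card {p \<in> A I1. descents n (inv' p) \<subseteq> L} =
      card {p \<in> A I2. descents n (inv' p) \<subseteq> L}" for L
    using card_descent_restricted_cong[OF I1(1) I2(1) deg] by (simp only:)
  have eq: "card {p \<in> A I1. descents n (inv' p) = L} =
      card {p \<in> A I2. descents n (inv' p) = L}" if "L \<subseteq> {1..<n}" for L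
    by (rule card_eq_if_card_subset_eq[OF fin fin sub finite_subset[OF that finite_atLeastLessThan] that])
  \<comment> \<open>With the bound \<open>{1..<n}\<close> the condition on the inverse always holds,
    so \<open>sub\<close> compares the sizes of the sets \<open>A I\<close> themselves.\<close>
  have "{p \<in> A I. descents n (inv' p) \<subseteq> {1..<n}} = A I" for I by (auto simp: descents_def)
  then have all: "card (A I1) = card (A I2)" using sub[of "{1..<n}"] by (simp only:)
  note T1 = transition_matrix_eq_card_permutations[OF I1(1) K(1), folded I1(2) K(2)]
  note T2 = transition_matrix_eq_card_permutations[OF I2(1) K(1), folded I2(2) K(2)]
  show "transition_matrix (braid_automaton n) Z X1 = transition_matrix (braid_automaton n) Z X2"
  proof (cases "K = {}")
    case False
    then have "{p. p permutes {1..n} \<and> (if descents n p \<subseteq> I then descents n (inv' p) else {}) = K} =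
        {p \<in> A I. descents n (inv' p) = K}" for I
      by (auto simp: A_def)
    then show ?thesis
      using eq[OF K(1)] unfolding T1 T2 by simp
  next
    case True
    \<comment> \<open>The empty state is reached by the rejected letters and by the accepted letters
      with empty finishing set. The count is therefore made through the complement, the permutations
      in \<open>A I\<close> whose inverse has a descent.\<close>
    have "card {p. p permutes {1..n} \<and> (if descents n p \<subseteq> I then descents n (inv' p) else {}) = K} =
        card {p. p permutes {1..n}} - (card (A I) - card {p \<in> A I. descents n (inv' p) = {}})" for I
    proof -
      have "{p. p permutes {1..n} \<and> (if descents n p \<subseteq> I then descents n (inv' p) else {}) = K} =
          {p. p permutes {1..n}} - (A I - {p \<in> A I. descents n (inv' p) = {}})"
        using True by (auto simp: A_def)
      moreover have "A I - {p \<in> A I. descents n (inv' p) = {}} \<subseteq> {p. p permutes {1..n}}"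
        by (auto simp: A_def)
      ultimately show ?thesis
        using fin[of I] by (simp add: card_Diff_subset finite_subset)
    qed
    then show ?thesis
      using eq[of "{}"] all unfolding T1 T2 by simp
  qed
qed

end
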